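(* Let $\alpha>0$. Let $x_1>x_2>\cdots$ be a realization of the Airy kernel point process. Let $y_1,y_2,\dots$ be independent random variables with common distribution function $$G_\alpha(x)=\frac{e^{\alpha x}}{1+e^{\alpha x}},$$ which are also independent of $\{x_i\}$. Define $z_j=x_j+y_j$ for $j\ge1$. Then for every real $\xi$, $$\mathbb{P}\big[\max_{j\ge1}z_j\le\xi\big]=F_\alpha(\xi).$$
   Context: $\mathrm{Ai}$ is the Airy function. The Airy kernel point process is the determinantal point process on $\mathbb{R}$ with correlation kernel $K_{\mathrm{Airy}}(x,y)=\int_0^\infty\mathrm{Ai}(x+\lambda)\mathrm{Ai}(y+\lambda)\,d\lambda$, i.e. its correlation functions with respect to Lebesgue measure are $\det(K_{\mathrm{Airy}}(x_i,x_j))_{1\le i,j\le k}$, $k\ge 1$; almost surely it has infinitely many particles and a rightmost one. $F_\alpha(\xi)=\det(I-M_\alpha)_{L^2(\xi,\infty)}=\sum_{n=0}^\infty\frac{(-1)^n}{n!}\int_{(\xi,\infty)^n}\det(M_\alpha(x_i,x_j))_{1\le i,j\le n}\,d^nx$, where $M_\alpha(x,y)=\int_{-\infty}^\infty\frac{e^{\alpha\lambda}}{e^{\alpha\lambda}+1}\mathrm{Ai}(x+\lambda)\mathrm{Ai}(y+\lambda)\,d\lambda$; $F_\alpha$ is the distribution function of the last particle of the determinantal process with kernel $M_\alpha$. *)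

theory Defs
  imports
    "HOL-Probability.Probability"
    "Jordan_Normal_Form.Determinant"
begin

(* Ai(x) = 1/pi int_0^oo cos(t^3/3 + x t) dt as a conditionally convergent improper integral.
   The Henstock-Kurzweil integral over an unbounded set is the limit of the integrals over
   compact boxes; the Lebesgue integral would not exist. *)
definition Airy_Ai :: "real \<Rightarrow> real" where
  "Airy_Ai x = integral {0..} (\<lambda>t. cos (t ^ 3 / 3 + x * t)) / pi"

definition Airy_kernel :: "real \<Rightarrow> real \<Rightarrow> real" where
  "Airy_kernel x y = (LBINT l:{0<..}. Airy_Ai (x + l) * Airy_Ai (y + l))"

definition M_kernel :: "real \<Rightarrow> real \<Rightarrow> real \<Rightarrow> real" where
  "M_kernel \<alpha> x y =
     (LBINT l. exp (\<alpha> * l) / (exp (\<alpha> * l) + 1) * Airy_Ai (x + l) * Airy_Ai (y + l))"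

definition kernel_det :: "(real \<Rightarrow> real \<Rightarrow> real) \<Rightarrow> nat \<Rightarrow> (nat \<Rightarrow> real) \<Rightarrow> real" where
  "kernel_det K n x = Determinant.det (Matrix.mat n n (\<lambda>(i, j). K (x i) (x j)))"

(* det(I - K) on L^2(A), as the Fredholm series. *)
definition Fredholm_det :: "(real \<Rightarrow> real \<Rightarrow> real) \<Rightarrow> real set \<Rightarrow> real" where
  "Fredholm_det K A =
     (\<Sum>n. (-1) ^ n / fact n *
        (LINT x : (\<Pi>\<^sub>E i\<in>{..<n}. A) | Pi\<^sub>M {..<n} (\<lambda>_. lborel). kernel_det K n x))"

definition F_dist :: "real \<Rightarrow> real \<Rightarrow> real" where
  "F_dist \<alpha> \<xi> = Fredholm_det (M_kernel \<alpha>) {\<xi><..}"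

definition G_dist :: "real \<Rightarrow> real \<Rightarrow> real" where
  "G_dist \<alpha> x = exp (\<alpha> * x) / (1 + exp (\<alpha> * x))"

(* A simple point process on the line, given by its random set of particles. *)
definition point_process :: "'w measure \<Rightarrow> ('w \<Rightarrow> real set) \<Rightarrow> bool" where
  "point_process M S \<longleftrightarrow>
     (AE \<omega> in M. \<forall>B. compact B \<longrightarrow> finite (S \<omega> \<inter> B)) \<and>
     (\<forall>B\<in>sets borel. (\<lambda>\<omega>. emeasure (count_space UNIV) (S \<omega> \<inter> B)) \<in> borel_measurable M)"

(* \<rho> is the k-point correlation function with respect to Lebesgue measure: the density of the
   k-th factorial moment measure, which maps A to the expected number of ordered k-tuples of
   distinct particles lying in A.  Points of real^k are functions on {..<k}; both sides may be
   infinite. *)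
definition correlation_function ::
    "'w measure \<Rightarrow> ('w \<Rightarrow> real set) \<Rightarrow> nat \<Rightarrow> ((nat \<Rightarrow> real) \<Rightarrow> real) \<Rightarrow> bool" where
  "correlation_function M S k \<rho> \<longleftrightarrow>
     \<rho> \<in> borel_measurable (Pi\<^sub>M {..<k} (\<lambda>_. lborel)) \<and>
     (AE x in Pi\<^sub>M {..<k} (\<lambda>_. lborel). 0 \<le> \<rho> x) \<and>
     (\<forall>A\<in>sets (Pi\<^sub>M {..<k} (\<lambda>_. lborel)).
        (\<integral>\<^sup>+ \<omega>. emeasure (count_space UNIV)
                  {x \<in> A. inj_on x {..<k} \<and> x ` {..<k} \<subseteq> S \<omega>} \<partial>M)
        = (\<integral>\<^sup>+ x\<in>A. ennreal (\<rho> x) \<partial>Pi\<^sub>M {..<k} (\<lambda>_. lborel)))"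

definition determinantal_point_process ::
    "'w measure \<Rightarrow> ('w \<Rightarrow> real set) \<Rightarrow> (real \<Rightarrow> real \<Rightarrow> real) \<Rightarrow> bool" where
  "determinantal_point_process M S K \<longleftrightarrow>
     point_process M S \<and> (\<forall>k\<ge>1. correlation_function M S k (kernel_det K k))"

end

theory Submission
  imports Defs "HOL-Real_Asymp.Real_Asymp"
begin

text \<open>
  Put \<open>g x = 1 - G (\<xi> - x)\<close>.  Conditioning on the particles,
  \<open>P (\<forall>j. x\<^sub>j + y\<^sub>j \<le> \<xi>) = E (\<Prod>j. 1 - g x\<^sub>j)\<close>, and inclusion-exclusion together with the
  correlation functions turns this into the Fredholm series of \<open>\<surd>g K \<surd>g\<close>, where \<open>K\<close> is the Airy kernel.
  Now \<open>\<surd>g K \<surd>g = B B\<^sup>T\<close> with \<open>B x l = \<surd>(g x) Ai (x + l - \<xi>)\<close> on \<open>l > \<xi>\<close>, while \<open>B\<^sup>T B\<close> is exactly \<open>M\<^sub>\<alpha>\<close> on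
  \<open>L\<^sup>2 (\<xi>, \<infinity>)\<close>.  By Andreief's identity the \<open>n\<close>-th terms of the two Fredholm series are both the
  integral of \<open>(det (B (x\<^sub>i, l\<^sub>k)))\<^sup>2 / n!\<close> over all \<open>x\<close> and \<open>l\<close>, so they agree by Tonelli.
  Hadamard's inequality and the square integrability of \<open>B\<close> give absolute convergence; the latter needs
  only \<open>Ai u = O (u\<^sup>-\<^sup>2)\<close> at \<open>\<infinity>\<close> and polynomial growth at \<open>-\<infinity>\<close>, obtained by integrating by parts twice.
  The maximum is attained almost surely by Borel-Cantelli, since the first term of the series is finite
  for every \<open>\<xi>\<close>.
\<close>

section \<open>Bounds for the Airy function\<close>

text \<open>Every sufficiently large box meets \<open>{a..}\<close> in an interval
  \<open>{a..b}\<close> with \<open>b\<close> large, so its integral is \<open>F b\<close>. Absolute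
  convergence does not enter, which is essential: the Airy integral converges only
  conditionally.\<close>

lemma has_integral_Ici_limit:
  fixes f :: "real \<Rightarrow> real"
  assumes f: "\<And>b. a \<le> b \<Longrightarrow> (f has_integral F b) {a..b}" and lim: "(F \<longlongrightarrow> L) at_top"
  shows "(f has_integral L) {a..}"
proof -
  have restr: "(\<lambda>x. if x \<in> {a..} then f x else 0) integrable_on cbox c b" for c b
  proof -
    have "f integrable_on {max a c..b}"
    proof (cases "a \<le> b")
      case True
      then show ?thesis
        using integrable_on_subinterval[OF has_integral_integrable[OF f[OF True]], of "max a c" b] by auto
    qed auto
    moreover have "{a..} \<inter> {c..b} = {max a c..b}" by auto
    ultimately show ?thesis
      using integrable_restrict_Int[of "{a..}" f "{c..b}"] by simp
  qed
  show ?thesis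
    unfolding has_integral_alt'
  proof (intro conjI allI impI restr)
    fix e :: real assume "e > 0"
    then obtain N where N: "\<And>b. b \<ge> N \<Longrightarrow> \<bar>F b - L\<bar> < e"
      using tendstoD[OF lim] by (auto simp: eventually_at_top_linorder dist_real_def)
    show "\<exists>B>0. \<forall>c b. ball 0 B \<subseteq> cbox c b \<longrightarrow>
      norm (integral (cbox c b) (\<lambda>x. if x \<in> {a..} then f x else 0) - L) < e"
    proof (intro exI[of _ "max \<bar>a\<bar> \<bar>N\<bar> + 1"] conjI allI impI)
      fix c b :: real assume sub: "ball 0 (max \<bar>a\<bar> \<bar>N\<bar> + 1) \<subseteq> cbox c b"
      \<comment> \<open>These two points of the ball force the box to start left of \<open>a\<close>
        and to end beyond both \<open>a\<close> and \<open>N\<close>.\<close>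
      have "- \<bar>a\<bar> \<in> ball 0 (max \<bar>a\<bar> \<bar>N\<bar> + 1)" "max \<bar>a\<bar> \<bar>N\<bar> \<in> ball 0 (max \<bar>a\<bar> \<bar>N\<bar> + 1)" by auto
      then have "- \<bar>a\<bar> \<in> cbox c b" "max \<bar>a\<bar> \<bar>N\<bar> \<in> cbox c b" using sub by blast+
      then have *: "c \<le> a" "a \<le> b" "N \<le> b" by auto
      then have "{a..} \<inter> {c..b} = {a..b}" by auto
      then have "integral (cbox c b) (\<lambda>x. if x \<in> {a..} then f x else 0) = F b"
        using f[OF \<open>a \<le> b\<close>] integral_restrict_Int[of "{c..b}" "{a..}" f]
        by (simp add: integral_unique del: Int_atLeastAtMostR1 Int_atLeastAtMostR2)
      then show "norm (integral (cbox c b) (\<lambda>x. if x \<in> {a..} then f x else 0) - L) < e"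
        using N[OF \<open>N \<le> b\<close>] by simp
    qed auto
  qed
qed

text \<open>A converse along the integers. It exhibits \<open>Airy_Ai\<close> as a pointwise limit
  of integrals over compact intervals, which are continuous in the parameter; hence
  \<open>Airy_Ai\<close> is Borel.\<close>

lemma integral_Ici_tendsto:
  fixes f :: "real \<Rightarrow> real"
  assumes "f integrable_on {a..}"
  shows "(\<lambda>n. integral {a..real n} f) \<longlonglongrightarrow> integral {a..} f"
proof (rule LIMSEQ_I)
  fix e :: real assume "e > 0"
  then obtain B where B: "B > 0" "\<And>c b. ball 0 B \<subseteq> cbox c b \<Longrightarrow>
      norm (integral (cbox c b) (\<lambda>x. if x \<in> {a..} then f x else 0) - integral {a..} f) < e"
    using integrable_integral[OF assms] unfolding has_integral_alt' by blast
  obtain N where N: "real N > B" using reals_Archimedean2 by blast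
  show "\<exists>no. \<forall>n\<ge>no. norm (integral {a..real n} f - integral {a..} f) < e"
  proof (intro exI allI impI)
    fix n assume "N \<le> n"
    then have "ball 0 B \<subseteq> cbox (min a (- B)) (real n)"
      using N by (auto simp: dist_real_def)
    then have "norm (integral (cbox (min a (- B)) (real n)) (\<lambda>x. if x \<in> {a..} then f x else 0) - integral {a..} f) < e"
      by (rule B(2))
    moreover have "{a..} \<inter> {min a (- B)..real n} = {a..real n}" by auto
    ultimately show "norm (integral {a..real n} f - integral {a..} f) < e"
      using integral_restrict_Int[of "{min a (- B)..real n}" "{a..}" f] by simp
  qed
qed

text \<open>\<open>P\<close> is the boundary term left by two integrations by parts.\<close>

lemma Airy_phase_integral:
  fixes x T m :: real
  defines "P \<equiv> \<lambda>t. sin (t ^ 3 / 3 + x * t) / (t\<^sup>2 + x) - cos (t ^ 3 / 3 + x * t) * (2 * t) / (t\<^sup>2 + x) ^ 3"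
  assumes T: "0 \<le> T" and m: "1 \<le> m"
    and phm: "\<And>t. T \<le> t \<Longrightarrow> m \<le> t\<^sup>2 + x"
    and ph: "\<And>t. T \<le> t \<Longrightarrow> (1 + t\<^sup>2) / 2 \<le> t\<^sup>2 + x"
  shows "\<exists>I. ((\<lambda>t. cos (t ^ 3 / 3 + x * t)) has_integral I) {T..} \<and> \<bar>I + P T\<bar> \<le> 52 * pi / m\<^sup>2"
proof -
  \<comment> \<open>With the phase derivative \<open>p = t\<^sup>2 + x\<close>, two integrations by
    parts give \<open>P' = cos - R\<close>: the sine terms cancel and \<open>R\<close> is of order
    \<open>1 / p ^ 3\<close>.\<close>
  define R where "R = (\<lambda>t. cos (t ^ 3 / 3 + x * t) * (2 / (t\<^sup>2 + x) ^ 3 - 12 * t\<^sup>2 / (t\<^sup>2 + x) ^ 4))"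
  \<comment> \<open>Since \<open>t\<^sup>2 \<le> 2 * p\<close>, the remainder is at most
    \<open>26 / p ^ 3\<close> with 26 = 2 + 24. Two factors \<open>1 / p\<close> are bounded by
    \<open>1 / m\<close>, the third by \<open>2 / (1 + t\<^sup>2)\<close>, which supplies
    integrability and doubles 26 to 52.\<close>
  define w where "w = (\<lambda>t::real. 52 / m\<^sup>2 * (1 / (1 + t\<^sup>2)))"
  have pos: "0 < t\<^sup>2 + x" if "T \<le> t" for t using phm[OF that] m by simp
  have Rw: "norm (R t) \<le> w t" if t: "T \<le> t" for t
  proof -
    define p where "p = t\<^sup>2 + x"
    have p: "m \<le> p" "(1 + t\<^sup>2) / 2 \<le> p" "0 < p" "t\<^sup>2 \<le> 2 * p"
      using phm[OF t] ph[OF t] pos[OF t] by (auto simp: p_def field_simps)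
    have "\<bar>R t\<bar> \<le> \<bar>2 / p ^ 3 - 12 * t\<^sup>2 / p ^ 4\<bar>"
      unfolding R_def p_def[symmetric] by (simp add: abs_mult mult_left_le_one_le)
    also have "\<dots> \<le> 2 / p ^ 3 + 12 * t\<^sup>2 / p ^ 4"
      using p(3) abs_triangle_ineq4[of "2 / p ^ 3" "12 * t\<^sup>2 / p ^ 4"] by simp
    also have "12 * t\<^sup>2 / p ^ 4 \<le> 12 * (2 * p) / p ^ 4"
      using p by (intro divide_right_mono mult_left_mono) auto
    also have "2 / p ^ 3 + 12 * (2 * p) / p ^ 4 = 26 / p\<^sup>2 * (1 / p)"
      using p(3) by (simp add: field_simps eval_nat_numeral)
    also have "\<dots> \<le> 26 / m\<^sup>2 * (1 / ((1 + t\<^sup>2) / 2))"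
      using p m by (intro mult_mono divide_left_mono power_mono) (auto simp: add_pos_nonneg intro!: mult_pos_pos)
    finally show ?thesis by (simp add: w_def)
  qed
  have w: "(w has_integral 52 / m\<^sup>2 * (pi / 2 - arctan T)) {T..}"
    unfolding w_def
  proof (intro has_integral_mult_right has_integral_Ici_limit)
    fix b assume "T \<le> b"
    then show "((\<lambda>t. 1 / (1 + t\<^sup>2)) has_integral (arctan b - arctan T)) {T..b}"
      by (intro fundamental_theorem_of_calculus)
        (auto simp flip: has_real_derivative_iff_has_vector_derivative
          intro!: derivative_eq_intros simp: divide_inverse)
  qed (intro tendsto_diff tendsto_arctan_at_top tendsto_const)
  have contR: "continuous_on {T..} R"
    unfolding R_def using pos by (intro continuous_intros) force+
  have Rabs: "R absolutely_integrable_on {T..}"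
  proof (rule measurable_bounded_by_integrable_imp_absolutely_integrable)
    show "R \<in> borel_measurable (lebesgue_on {T..})"
      by (intro continuous_imp_measurable_on_sets_lebesgue contR) auto
  qed (use w Rw in auto)
  then have Rint: "R integrable_on {T..}" by (rule set_lebesgue_integral_eq_integral)
  have Rbound: "\<bar>integral {T..} R\<bar> \<le> 52 * pi / m\<^sup>2"
  proof -
    have "norm (integral {T..} R) \<le> integral {T..} w"
      using w Rw by (intro integral_norm_bound_integral Rint) auto
    also have "\<dots> = 52 / m\<^sup>2 * (pi / 2 - arctan T)" using w by (rule integral_unique)
    also have "\<dots> \<le> 52 / m\<^sup>2 * pi"
      using arctan_lbound[of T] by (intro mult_left_mono) auto
    finally show ?thesis by simp
  qed
  have dP: "(P has_real_derivative cos (t ^ 3 / 3 + x * t) - R t) (at t within S)" if "T \<le> t" for t S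
  proof -
    define p where "p = t\<^sup>2 + x"
    have p: "p \<noteq> 0" using pos[OF that] by (simp add: p_def)
    have "(P has_real_derivative
        (cos (t ^ 3 / 3 + x * t) * p * p - sin (t ^ 3 / 3 + x * t) * (2 * t)) / (p * p) -
        ((- sin (t ^ 3 / 3 + x * t) * p * (2 * t) + cos (t ^ 3 / 3 + x * t) * 2) * p ^ 3
         - cos (t ^ 3 / 3 + x * t) * (2 * t) * (3 * p\<^sup>2 * (2 * t))) / (p ^ 3 * p ^ 3)) (at t within S)"
      unfolding P_def p_def
      by (rule derivative_eq_intros refl | use p in \<open>simp add: p_def power2_eq_square algebra_simps\<close>)+
    also have "(cos (t ^ 3 / 3 + x * t) * p * p - sin (t ^ 3 / 3 + x * t) * (2 * t)) / (p * p) -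
        ((- sin (t ^ 3 / 3 + x * t) * p * (2 * t) + cos (t ^ 3 / 3 + x * t) * 2) * p ^ 3
         - cos (t ^ 3 / 3 + x * t) * (2 * t) * (3 * p\<^sup>2 * (2 * t))) / (p ^ 3 * p ^ 3)
        = cos (t ^ 3 / 3 + x * t) - R t"
      unfolding R_def p_def[symmetric] using p by (simp add: field_simps eval_nat_numeral)
    finally show ?thesis .
  qed
  have Plim: "(P \<longlongrightarrow> 0) at_top"
  proof (rule Lim_null_comparison)
    show "eventually (\<lambda>t. norm (P t) \<le> 2 / (1 + t\<^sup>2) + 2 * t * (2 / (1 + t\<^sup>2))) at_top"
      using eventually_ge_at_top[of T]
    proof eventually_elim
      case (elim t)
      define p where "p = t\<^sup>2 + x"
      have p: "1 \<le> p" "(1 + t\<^sup>2) / 2 \<le> p"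
        using phm[OF elim] ph[OF elim] m by (auto simp: p_def field_simps)
      have t0: "0 \<le> t" using T elim by simp
      have p1: "1 / p \<le> 2 / (1 + t\<^sup>2)"
        using p by (simp add: field_simps add_pos_nonneg)
      have p3: "1 / p ^ 3 \<le> 1 / p"
        using p power_increasing[of 1 3 p] by (intro divide_left_mono) auto
      have "\<bar>P t\<bar> \<le> \<bar>sin (t ^ 3 / 3 + x * t)\<bar> * (1 / p) + \<bar>cos (t ^ 3 / 3 + x * t)\<bar> * (2 * t * (1 / p ^ 3))"
        unfolding P_def p_def[symmetric] using p t0
        by (intro order_trans[OF abs_triangle_ineq4]) (simp add: abs_mult)
      also have "\<dots> \<le> 1 * (1 / p) + 1 * (2 * t * (1 / p ^ 3))"
        using p t0 by (intro add_mono mult_right_mono) auto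
      also have "\<dots> \<le> 2 / (1 + t\<^sup>2) + 2 * t * (2 / (1 + t\<^sup>2))"
        using p1 p3 t0 by (intro add_mono) (auto intro!: mult_left_mono simp del: times_divide_eq_right)
      finally show ?case by simp
    qed
    show "((\<lambda>t::real. 2 / (1 + t\<^sup>2) + 2 * t * (2 / (1 + t\<^sup>2))) \<longlongrightarrow> 0) at_top"
      by real_asymp
  qed
  have "((\<lambda>t. cos (t ^ 3 / 3 + x * t) - R t) has_integral (0 - P T)) {T..}"
  proof (rule has_integral_Ici_limit)
    fix b assume "T \<le> b"
    then show "((\<lambda>t. cos (t ^ 3 / 3 + x * t) - R t) has_integral (P b - P T)) {T..b}"
      by (intro fundamental_theorem_of_calculus)
        (auto simp flip: has_real_derivative_iff_has_vector_derivative intro!: dP)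
  qed (intro tendsto_diff Plim tendsto_const)
  \<comment> \<open>The cosine is recovered as the exact derivative \<open>P'\<close>, integrated
    improperly, plus the absolutely integrable \<open>R\<close>.\<close>
  from has_integral_add[OF this integrable_integral[OF Rint]]
  have "((\<lambda>t. cos (t ^ 3 / 3 + x * t)) has_integral (integral {T..} R - P T)) {T..}"
    by simp
  then show ?thesis using Rbound by (intro exI conjI) auto
qed

text \<open>The integral is split at \<open>T = sqrt (2 * \<bar>x\<bar> + 2)\<close>. Past
  \<open>T\<close> the phase derivative is at least 1 and at least
  \<open>(1 + t\<^sup>2) / 2\<close>, so the phase lemma applies with \<open>m = 1\<close>. The part
  before \<open>T\<close> contributes at most \<open>T\<close>, the boundary term at most
  \<open>1 + 2 * T\<close>.\<close>

lemma Airy_integrable_bound: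
  "(\<lambda>t. cos (t ^ 3 / 3 + x * t)) integrable_on {0..} \<and> \<bar>pi * Airy_Ai x\<bar> \<le> 1 + 3 * sqrt (2 * \<bar>x\<bar> + 2) + 52 * pi"
proof -
  define T where "T = sqrt (2 * \<bar>x\<bar> + 2)"
  define P where "P = (\<lambda>t. sin (t ^ 3 / 3 + x * t) / (t\<^sup>2 + x) - cos (t ^ 3 / 3 + x * t) * (2 * t) / (t\<^sup>2 + x) ^ 3)"
  have T: "0 \<le> T" "T\<^sup>2 = 2 * \<bar>x\<bar> + 2" by (auto simp: T_def)
  have t2: "2 * \<bar>x\<bar> + 2 \<le> t\<^sup>2" if "T \<le> t" for t
    using power_mono[OF that T(1), of 2] T(2) by simp
  obtain I where I: "((\<lambda>t. cos (t ^ 3 / 3 + x * t)) has_integral I) {T..}" "\<bar>I + P T\<bar> \<le> 52 * pi / 1\<^sup>2"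
    using Airy_phase_integral[of T 1 x] T(1) t2 unfolding P_def by force
  have PT: "\<bar>P T\<bar> \<le> 1 + 2 * T"
  proof -
    have p: "1 \<le> T\<^sup>2 + x" using T(2) by linarith
    have "\<bar>P T\<bar> \<le> \<bar>sin (T ^ 3 / 3 + x * T)\<bar> * (1 / (T\<^sup>2 + x)) + \<bar>cos (T ^ 3 / 3 + x * T)\<bar> * (2 * T * (1 / (T\<^sup>2 + x) ^ 3))"
      unfolding P_def using p T(1)
      by (intro order_trans[OF abs_triangle_ineq4]) (simp add: abs_mult)
    also have "\<dots> \<le> 1 * 1 + 1 * (2 * T * 1)"
      using p T(1) by (intro add_mono mult_mono) auto
    finally show ?thesis by simp
  qed
  define J where "J = integral {0..T} (\<lambda>t. cos (t ^ 3 / 3 + x * t))"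
  have int0: "(\<lambda>t. cos (t ^ 3 / 3 + x * t)) integrable_on {0..T}"
    by (intro integrable_continuous_real continuous_intros) auto
  have J: "\<bar>J\<bar> \<le> T"
  proof -
    have "norm J \<le> integral {0..T} (\<lambda>t. 1)"
      unfolding J_def by (rule integral_norm_bound_integral[OF int0]) auto
    then show ?thesis using T(1) by simp
  qed
  have "((\<lambda>t. cos (t ^ 3 / 3 + x * t)) has_integral (J + I)) ({0..T} \<union> {T..})"
    using int0 by (intro has_integral_Un I(1)) (auto simp: J_def Int_atLeastAtMostL1 intro: negligible_subset[of "{T}"])
  moreover have "{0..T} \<union> {T..} = {0..}" using T(1) by auto
  ultimately have *: "((\<lambda>t. cos (t ^ 3 / 3 + x * t)) has_integral (J + I)) {0..}" by simp
  moreover have "pi * Airy_Ai x = J + I"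
    unfolding Airy_Ai_def using * by (simp add: integral_unique)
  moreover have "\<bar>J + I\<bar> \<le> 1 + 3 * T + 52 * pi"
    using I(2) J PT by simp
  ultimately show ?thesis unfolding T_def by auto
qed

text \<open>For \<open>x \<ge> 1\<close> the phase derivative is at least \<open>x\<close> on the
  whole half-line, so the phase lemma applies with \<open>T = 0\<close> and \<open>m = x\<close>.
  Both boundary terms vanish at 0 and only the remainder is left.\<close>

lemma Airy_decay:
  assumes "1 \<le> x"
  shows "\<bar>Airy_Ai x\<bar> \<le> 52 / x\<^sup>2"
proof -
  obtain I where I: "((\<lambda>t. cos (t ^ 3 / 3 + x * t)) has_integral I) {0..}" "\<bar>I\<bar> \<le> 52 * pi / x\<^sup>2"
  proof (atomize_elim)
    have "(1 + t\<^sup>2) / 2 \<le> t\<^sup>2 + x" for t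
    proof -
      have "0 \<le> t\<^sup>2" by simp
      then have "1 + t\<^sup>2 \<le> (t\<^sup>2 + x) * 2" using assms by argo
      then show ?thesis by simp
    qed
    then show "\<exists>I. ((\<lambda>t. cos (t ^ 3 / 3 + x * t)) has_integral I) {0..} \<and> \<bar>I\<bar> \<le> 52 * pi / x\<^sup>2"
      using Airy_phase_integral[of 0 x x] assms by simp
  qed
  have "pi * Airy_Ai x = I"
    unfolding Airy_Ai_def using I by (simp add: integral_unique)
  then have "pi * \<bar>Airy_Ai x\<bar> \<le> pi * (52 / x\<^sup>2)"
    using I(2) by (simp add: abs_mult[symmetric] mult.commute)
  then show ?thesis by (subst (asm) mult_le_cancel_left_pos) auto
qed

lemma Airy_Ai_measurable [measurable]: "Airy_Ai \<in> borel_measurable borel"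
proof (rule borel_measurable_LIMSEQ_real)
  fix x
  show "(\<lambda>n. integral {0..real n} (\<lambda>t. cos (t ^ 3 / 3 + x * t)) / pi) \<longlonglongrightarrow> Airy_Ai x"
    unfolding Airy_Ai_def
    using Airy_integrable_bound[of x] by (intro tendsto_divide integral_Ici_tendsto) auto
next
  fix n
  have "continuous_on UNIV (\<lambda>x. integral (cbox 0 (real n)) (\<lambda>t. cos (t ^ 3 / 3 + x * t)))"
    by (rule integral_continuous_on_param) (auto simp: case_prod_unfold intro!: continuous_intros)
  then show "(\<lambda>x. integral {0..real n} (\<lambda>t. cos (t ^ 3 / 3 + x * t)) / pi) \<in> borel_measurable borel"
    by (intro borel_measurable_continuous_onI continuous_on_divide) auto
qed

section \<open>Hadamard's inequality for positive semidefinite matrices\<close>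

lemma psd_diag_nonneg:
  fixes K :: "nat \<Rightarrow> nat \<Rightarrow> real"
  assumes psd: "\<And>c. 0 \<le> (\<Sum>i<n. \<Sum>j<n. c i * c j * K i j)" and i: "i < n"
  shows "0 \<le> K i i"
proof -
  define c where "c = (\<lambda>k. if k = i then 1 else 0 :: real)"
  have single: "(\<Sum>k<n. c k * f k) = f i" for f :: "nat \<Rightarrow> real"
    using i by (simp add: c_def if_distrib[of "\<lambda>x. x * _"] cong: if_cong)
  have "(\<Sum>k<n. \<Sum>l<n. c k * c l * K k l) = (\<Sum>k<n. c k * (\<Sum>l<n. c l * K k l))"
    by (simp add: sum_distrib_left mult.assoc)
  also have "\<dots> = K i i" by (simp add: single)
  finally show ?thesis using psd[of c] by simp
qed

text \<open>Evaluated at \<open>s\<close> times the \<open>i\<close>-th unit vector plus the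
  \<open>j\<close>-th, the quadratic form is affine in \<open>s\<close> when
  \<open>K i i = 0\<close>. A nonnegative affine function has slope zero.\<close>

lemma psd_pivot_zero:
  fixes K :: "nat \<Rightarrow> nat \<Rightarrow> real"
  assumes sym: "\<And>i j. i < n \<Longrightarrow> j < n \<Longrightarrow> K i j = K j i"
    and psd: "\<And>c. 0 \<le> (\<Sum>i<n. \<Sum>j<n. c i * c j * K i j)"
    and i: "i < n" and j: "j < n" and Kii: "K i i = 0"
  shows "K i j = 0"
proof (cases "i = j")
  case False
  have quad: "0 \<le> 2 * s * K i j + K j j" for s
  proof -
    define c where "c = (\<lambda>k. if k = i then s else if k = j then 1 else 0)"
    have single: "(\<Sum>k<n. c k * f k) = s * f i + f j" for f :: "nat \<Rightarrow> real"
    proof -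
      have "(\<Sum>k<n. c k * f k) = (\<Sum>k\<in>{i, j}. c k * f k)"
        using i j by (intro sum.mono_neutral_right) (auto simp: c_def)
      then show ?thesis using False by (simp add: c_def)
    qed
    have "(\<Sum>k<n. \<Sum>l<n. c k * c l * K k l) = (\<Sum>k<n. c k * (\<Sum>l<n. c l * K k l))"
      by (simp add: sum_distrib_left mult.assoc)
    also have "\<dots> = (\<Sum>k<n. c k * (s * K k i + K k j))"
      by (simp add: single)
    also have "\<dots> = s * (s * K i i + K i j) + (s * K j i + K j j)"
      by (rule single)
    also have "\<dots> = 2 * s * K i j + K j j"
      using sym[OF i j] Kii by simp
    finally show ?thesis using psd[of c] by simp
  qed
  show ?thesis
  proof (rule ccontr)
    assume "K i j \<noteq> 0"
    \<comment> \<open>The chosen \<open>s\<close> gives the quadratic form the value -1.\<close>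
    then show False
      using quad[of "- (K j j + 1) / (2 * K i j)"] by (simp add: field_simps)
  qed
qed (use Kii in simp)

text \<open>One step of Gaussian elimination as a factorisation \<open>L * U\<close>:
  \<open>L\<close> is unit lower triangular, the first column of \<open>U\<close> vanishes below the
  pivot, and the remaining block is the Schur complement.\<close>

lemma det_pivot:
  fixes K :: "nat \<Rightarrow> nat \<Rightarrow> real"
  assumes "K 0 0 \<noteq> 0"
  shows "Determinant.det (Matrix.mat (Suc n) (Suc n) (\<lambda>(i, j). K i j)) =
    K 0 0 * Determinant.det (Matrix.mat n n (\<lambda>(i, j). K (Suc i) (Suc j) - K (Suc i) 0 * K 0 (Suc j) / K 0 0))"
proof -
  define A where "A = Matrix.mat (Suc n) (Suc n) (\<lambda>(i, j). K i j)"
  define L where "L = Matrix.mat (Suc n) (Suc n) (\<lambda>(i, j). if i = j then 1 else if j = 0 then K i 0 / K 0 0 else 0)"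
  define U where "U = Matrix.mat (Suc n) (Suc n) (\<lambda>(i, j). if i = 0 then K 0 j else K i j - K i 0 * K 0 j / K 0 0)"
  have carrier: "A \<in> carrier_mat (Suc n) (Suc n)" "L \<in> carrier_mat (Suc n) (Suc n)" "U \<in> carrier_mat (Suc n) (Suc n)"
    by (auto simp: A_def L_def U_def)
  have "A = L * U"
  proof (rule eq_matI)
    fix i j assume "i < dim_row (L * U)" "j < dim_col (L * U)"
    then have ij: "i < Suc n" "j < Suc n" by (auto simp: L_def U_def)
    have "(L * U) $$ (i, j) = (\<Sum>k\<in>{0..<Suc n}. L $$ (i, k) * U $$ (k, j))"
      using ij by (simp add: L_def U_def scalar_prod_def)
    also have "\<dots> = (\<Sum>k\<in>{0, i}. L $$ (i, k) * U $$ (k, j))"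
      using ij by (intro sum.mono_neutral_right) (auto simp: L_def)
    also have "\<dots> = K i j"
      using ij assms by (cases "i = 0") (auto simp: L_def U_def)
    finally show "A $$ (i, j) = (L * U) $$ (i, j)" using ij by (simp add: A_def)
  qed (auto simp: A_def L_def U_def)
  then have "Determinant.det A = Determinant.det L * Determinant.det U"
    using carrier by (simp add: det_mult)
  also have "Determinant.det L = 1"
  proof -
    have "Determinant.det L = prod_list (diag_mat L)"
      by (rule det_lower_triangular[OF _ carrier(2)]) (auto simp: L_def)
    also have "\<dots> = 1"
      by (auto simp: prod_list_diag_prod L_def intro!: prod.neutral)
    finally show ?thesis .
  qed
  also have "Determinant.det U = (\<Sum>i<Suc n. U $$ (i, 0) * cofactor U i 0)"
    using carrier by (intro laplace_expansion_column) auto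
  also have "\<dots> = (\<Sum>i\<in>{0}. U $$ (i, 0) * cofactor U i 0)"
    using assms by (intro sum.mono_neutral_right) (auto simp: U_def)
  also have "\<dots> = K 0 0 * Determinant.det (mat_delete U 0 0)"
    by (simp add: U_def cofactor_def)
  also have "mat_delete U 0 0 = Matrix.mat n n (\<lambda>(i, j). K (Suc i) (Suc j) - K (Suc i) 0 * K 0 (Suc j) / K 0 0)"
    by (rule eq_matI) (auto simp: U_def mat_delete_def)
  finally show ?thesis by (simp add: A_def)
qed

text \<open>Induction through the Schur complement \<open>S\<close> of the pivot, which is again
  symmetric and positive semidefinite and whose diagonal is dominated by that of \<open>K\<close>,
  because a square divided by the pivot is subtracted. If the pivot is zero, the whole first row
  vanishes and both sides are 0.\<close>

lemma Hadamard_psd: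
  fixes K :: "nat \<Rightarrow> nat \<Rightarrow> real"
  assumes "\<And>i j. i < n \<Longrightarrow> j < n \<Longrightarrow> K i j = K j i"
    and "\<And>c. 0 \<le> (\<Sum>i<n. \<Sum>j<n. c i * c j * K i j)"
  shows "0 \<le> Determinant.det (Matrix.mat n n (\<lambda>(i, j). K i j)) \<and>
    Determinant.det (Matrix.mat n n (\<lambda>(i, j). K i j)) \<le> (\<Prod>i<n. K i i)"
  using assms
proof (induction n arbitrary: K)
  case (Suc n)
  note sym = Suc.prems(1) and psd = Suc.prems(2)
  have diag: "0 \<le> K i i" if "i < Suc n" for i
    using psd that by (rule psd_diag_nonneg)
  show ?case
  proof (cases "K 0 0 = 0")
    case True
    let ?A = "Matrix.mat (Suc n) (Suc n) (\<lambda>(i, j). K i j)"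
    have "K 0 j = 0" if "j < Suc n" for j
      by (rule psd_pivot_zero[of "Suc n", OF sym psd _ that True]) auto
    then have "Determinant.det ?A = 0"
      by (subst laplace_expansion_row[of _ "Suc n" 0]) (auto simp del: sum.lessThan_Suc intro!: sum.neutral)
    moreover have "(\<Prod>i<Suc n. K i i) = 0"
      using True by (auto simp del: prod.lessThan_Suc intro!: prod_zero)
    ultimately show ?thesis by linarith
  next
    case False
    define k where "k = K 0 0"
    have k: "0 < k" using False diag[of 0] by (simp add: k_def)
    define S where "S = (\<lambda>i j. K (Suc i) (Suc j) - K (Suc i) 0 * K 0 (Suc j) / k)"
    have symS: "S i j = S j i" if "i < n" "j < n" for i j
      using sym[of "Suc i" "Suc j"] sym[of "Suc i" 0] sym[of 0 "Suc j"] that by (simp add: S_def)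
    have psdS: "0 \<le> (\<Sum>i<n. \<Sum>j<n. c i * c j * S i j)" for c
    proof -
      define b where "b = (\<Sum>i<n. c i * K (Suc i) 0)"
      have b': "(\<Sum>i<n. c i * K 0 (Suc i)) = b"
        unfolding b_def using sym[of "Suc _" 0] by (intro sum.cong) auto
      \<comment> \<open>The first coordinate that minimises the quadratic form of \<open>K\<close>
        for given remaining coordinates \<open>c\<close>; the minimum is the form of
        \<open>S\<close> at \<open>c\<close>.\<close>
      define e where "e = - b / k"
      define d where "d = case_nat e c"
      define q where "q = (\<Sum>i<n. \<Sum>j<n. c i * c j * K (Suc i) (Suc j))"
      have "(\<Sum>i<Suc n. \<Sum>j<Suc n. d i * d j * K i j)
          = e * e * k + (\<Sum>j<n. e * c j * K 0 (Suc j)) + ((\<Sum>i<n. c i * e * K (Suc i) 0) + q)"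
        unfolding sum.lessThan_Suc_shift d_def by (simp add: sum.distrib q_def k_def)
      also have "(\<Sum>j<n. e * c j * K 0 (Suc j)) = e * (\<Sum>j<n. c j * K 0 (Suc j))"
        by (simp add: sum_distrib_left mult_ac)
      also have "(\<Sum>i<n. c i * e * K (Suc i) 0) = e * b"
        by (simp add: b_def sum_distrib_left mult_ac)
      also have "e * e * k + e * (\<Sum>j<n. c j * K 0 (Suc j)) + (e * b + q) = q - b * b / k"
        unfolding b' e_def using k by (simp add: field_simps)
      also have "\<dots> = (\<Sum>i<n. \<Sum>j<n. c i * c j * S i j)"
      proof -
        have "b * b / k = (\<Sum>i<n. c i * K (Suc i) 0) * (\<Sum>j<n. c j * K 0 (Suc j)) / k"
          unfolding b' by (simp add: b_def)
        also have "\<dots> = (\<Sum>i<n. \<Sum>j<n. c i * c j * (K (Suc i) 0 * K 0 (Suc j) / k))"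
          by (simp only: sum_product sum_divide_distrib) (simp add: mult_ac)
        finally show ?thesis
          by (simp add: q_def S_def right_diff_distrib sum_subtractf)
      qed
      finally show ?thesis using psd[of d] by simp
    qed
    have IH: "0 \<le> Determinant.det (Matrix.mat n n (\<lambda>(i, j). S i j))"
      "Determinant.det (Matrix.mat n n (\<lambda>(i, j). S i j)) \<le> (\<Prod>i<n. S i i)"
      using Suc.IH[of S] symS psdS by auto
    have Sdiag: "0 \<le> S i i \<and> S i i \<le> K (Suc i) (Suc i)" if "i < n" for i
    proof
      show "0 \<le> S i i" using psdS that by (rule psd_diag_nonneg)
      show "S i i \<le> K (Suc i) (Suc i)"
        using sym[of "Suc i" 0] that k by (simp add: S_def)
    qed
    have "Determinant.det (Matrix.mat (Suc n) (Suc n) (\<lambda>(i, j). K i j)) = k * Determinant.det (Matrix.mat n n (\<lambda>(i, j). S i j))"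
      using det_pivot[of K n, OF False] by (simp add: S_def k_def)
    moreover have "(\<Prod>i<n. S i i) \<le> (\<Prod>i<n. K (Suc i) (Suc i))"
      using Sdiag by (intro prod_mono) auto
    then have "k * Determinant.det (Matrix.mat n n (\<lambda>(i, j). S i j)) \<le> k * (\<Prod>i<n. K (Suc i) (Suc i))"
      using IH k by (intro mult_left_mono) auto
    ultimately show ?thesis
      using IH(1) k by (simp only: prod.lessThan_Suc_shift k_def) auto
  qed
qed auto

section \<open>Determinants of Gram kernels\<close>

lemma det_permutation_sum:
  fixes f :: "nat \<Rightarrow> nat \<Rightarrow> real"
  shows "Determinant.det (Matrix.mat n n (\<lambda>(i, j). f i j)) =
    (\<Sum>p | p permutes {..<n}. of_int (sign p) * (\<Prod>i<n. f i (p i)))"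
proof -
  have "Determinant.det (Matrix.mat n n (\<lambda>(i, j). f i j)) =
      (\<Sum>p | p permutes {0..<n}. signof p * (\<Prod>i = 0..<n. Matrix.mat n n (\<lambda>(i, j). f i j) $$ (i, p i)))"
    by (rule det_def') simp
  also have "\<dots> = (\<Sum>p | p permutes {0..<n}. signof p * (\<Prod>i = 0..<n. f i (p i)))"
    by (intro sum.cong prod.cong refl arg_cong2[of _ _ _ _ "(*)"]) (auto dest: permutes_in_image)
  finally show ?thesis by (simp add: lessThan_atLeast0)
qed

lemma det_mat_transpose:
  fixes f :: "nat \<Rightarrow> nat \<Rightarrow> real"
  shows "Determinant.det (Matrix.mat n n (\<lambda>(i, j). f i j)) = Determinant.det (Matrix.mat n n (\<lambda>(i, j). f j i))"
proof -
  have "Matrix.mat n n (\<lambda>(i, j). f j i) = transpose_mat (Matrix.mat n n (\<lambda>(i, j). f i j))"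
    by (rule eq_matI) auto
  then show ?thesis using det_transpose[of "Matrix.mat n n (\<lambda>(i, j). f i j)" n] by simp
qed

interpretation lborel_product: product_sigma_finite "\<lambda>_::nat. lborel :: real measure"
  by standard

text \<open>The square expands into a double Leibniz sum. Each term is a product over the
  coordinates \<open>l k\<close>, so its integral factorises into Gram entries. For every fixed
  \<open>p\<close> the sum over \<open>q\<close> is the same determinant, whence the factor
  \<open>fact n\<close>.\<close>

theorem Andreief:
  fixes \<phi> :: "nat \<Rightarrow> real \<Rightarrow> real"
  assumes int: "\<And>i j. i < n \<Longrightarrow> j < n \<Longrightarrow> integrable lborel (\<lambda>l. \<phi> i l * \<phi> j l)"
  shows "(\<integral>\<^sup>+ l. ennreal ((Determinant.det (Matrix.mat n n (\<lambda>(k, i). \<phi> i (l k))))\<^sup>2) \<partial>Pi\<^sub>M {..<n} (\<lambda>_. lborel)) =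
    ennreal (fact n * Determinant.det (Matrix.mat n n (\<lambda>(i, j). LBINT l. \<phi> i l * \<phi> j l)))"
proof -
  let ?P = "{p. p permutes {..<n}}"
  define K where "K = (\<lambda>i j. LBINT l. \<phi> i l * \<phi> j l)"
  define D where "D = (\<lambda>l. Determinant.det (Matrix.mat n n (\<lambda>(k, i). \<phi> i (l k))))"
  let ?t = "\<lambda>p q l. of_int (sign p) * of_int (sign q) * (\<Prod>k<n. \<phi> (p k) (l k) * \<phi> (q k) (l k))"
  have D2: "(D l)\<^sup>2 = (\<Sum>p\<in>?P. \<Sum>q\<in>?P. ?t p q l)" for l
    unfolding D_def det_permutation_sum power2_eq_square sum_product
    by (simp add: prod.distrib mult_ac)
  have term_int: "has_bochner_integral (Pi\<^sub>M {..<n} (\<lambda>_. lborel)) (?t p q)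
      (of_int (sign p) * of_int (sign q) * (\<Prod>k<n. K (p k) (q k)))"
    if "p \<in> ?P" "q \<in> ?P" for p q
  proof -
    have *: "integrable lborel (\<lambda>l. \<phi> (p k) l * \<phi> (q k) l)" if "k \<in> {..<n}" for k
      using that \<open>p \<in> ?P\<close> \<open>q \<in> ?P\<close> by (intro int) (auto simp: permutes_in_image dest: permutes_in_image[of _ "{..<n}" k])
    show ?thesis
      using lborel_product.product_integrable_prod[of "{..<n}" "\<lambda>k l. \<phi> (p k) l * \<phi> (q k) l", OF _ *]
        lborel_product.product_integral_prod[of "{..<n}" "\<lambda>k l. \<phi> (p k) l * \<phi> (q k) l", OF _ *]
      by (auto simp: has_bochner_integral_iff K_def)
  qed
  have D2_int: "has_bochner_integral (Pi\<^sub>M {..<n} (\<lambda>_. lborel)) (\<lambda>l. (D l)\<^sup>2)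
      (\<Sum>p\<in>?P. \<Sum>q\<in>?P. of_int (sign p) * of_int (sign q) * (\<Prod>k<n. K (p k) (q k)))"
    unfolding D2 by (intro has_bochner_integral_sum term_int)
  have inner: "(\<Sum>q\<in>?P. of_int (sign p) * of_int (sign q) * (\<Prod>k<n. K (p k) (q k)))
      = Determinant.det (Matrix.mat n n (\<lambda>(i, j). K i j))" if p: "p \<in> ?P" for p
  proof -
    \<comment> \<open>Substituting \<open>q = r \<circ> p\<close> cancels the sign of
      \<open>p\<close>, and permuting the product by \<open>p\<close> removes \<open>p\<close> from
      the indices.\<close>
    have "(\<Sum>q\<in>?P. of_int (sign p) * of_int (sign q) * (\<Prod>k<n. K (p k) (q k)))
        = (\<Sum>r\<in>?P. of_int (sign p) * of_int (sign (r \<circ> p)) * (\<Prod>k<n. K (p k) ((r \<circ> p) k)))"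
      using p by (intro sum_permutations_compose_right) auto
    also have "\<dots> = (\<Sum>r\<in>?P. of_int (sign r) * (\<Prod>k<n. K k (r k)))"
    proof (rule sum.cong)
      fix r assume r: "r \<in> ?P"
      have "permutation p" "permutation r"
        using p r by (auto simp: permutation_permutes intro: finite_lessThan)
      then have "of_int (sign p) * of_int (sign (r \<circ> p)) = (of_int (sign r) :: real)"
        by (simp add: sign_compose flip: of_int_mult)
      moreover have "(\<Prod>k<n. K (p k) (r (p k))) = (\<Prod>k<n. K k (r k))"
        using p prod.permute[of p "{..<n}" "\<lambda>k. K k (r k)"] by (simp add: o_def)
      ultimately show "of_int (sign p) * of_int (sign (r \<circ> p)) * (\<Prod>k<n. K (p k) ((r \<circ> p) k)) =
          of_int (sign r) * (\<Prod>k<n. K k (r k))"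
        by simp
    qed simp
    finally show ?thesis by (simp add: det_permutation_sum)
  qed
  have "has_bochner_integral (Pi\<^sub>M {..<n} (\<lambda>_. lborel)) (\<lambda>l. (D l)\<^sup>2)
      (fact n * Determinant.det (Matrix.mat n n (\<lambda>(i, j). K i j)))"
    using D2_int inner by (simp add: card_permutations)
  then have "(\<integral>\<^sup>+ l. ennreal ((D l)\<^sup>2) \<partial>Pi\<^sub>M {..<n} (\<lambda>_. lborel)) =
      ennreal (fact n * Determinant.det (Matrix.mat n n (\<lambda>(i, j). K i j)))"
    by (subst nn_integral_eq_integral) (auto simp: has_bochner_integral_iff)
  then show ?thesis by (simp add: D_def K_def)
qed

section \<open>Gram kernels: positivity, Hadamard bound, and exchange of the two variables\<close>

lemma integrable_mult_square:
  fixes f g :: "'a \<Rightarrow> real"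
  assumes [measurable]: "f \<in> borel_measurable M" "g \<in> borel_measurable M"
    and "integrable M (\<lambda>x. (f x)\<^sup>2)" "integrable M (\<lambda>x. (g x)\<^sup>2)"
  shows "integrable M (\<lambda>x. f x * g x)"
proof (rule Bochner_Integration.integrable_bound)
  show "integrable M (\<lambda>x. (f x)\<^sup>2 + (g x)\<^sup>2)" using assms by simp
  have "\<bar>a * b\<bar> \<le> a\<^sup>2 + b\<^sup>2" for a b :: real
    using sum_squares_bound[of "\<bar>a\<bar>" "\<bar>b\<bar>"] abs_ge_zero[of "a * b"] unfolding abs_mult power2_abs by linarith
  then show "AE x in M. norm (f x * g x) \<le> norm ((f x)\<^sup>2 + (g x)\<^sup>2)" by simp
qed simp

text \<open>The quadratic form of a Gram kernel is the integral of the square of a linear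
  combination of the functions \<open>\<phi> (x i)\<close>, so Hadamard's inequality
  applies.\<close>

lemma kernel_det_Gram:
  fixes \<phi> :: "real \<Rightarrow> real \<Rightarrow> real"
  assumes int: "\<And>x y. integrable lborel (\<lambda>l. \<phi> x l * \<phi> y l)"
  defines "K \<equiv> \<lambda>x y. LBINT l. \<phi> x l * \<phi> y l"
  shows "0 \<le> kernel_det K n x" "kernel_det K n x \<le> (\<Prod>i<n. K (x i) (x i))"
proof -
  have psd: "0 \<le> (\<Sum>i<n. \<Sum>j<n. c i * c j * K (x i) (x j))" for c
  proof -
    have "0 \<le> (LBINT l. (\<Sum>i<n. c i * \<phi> (x i) l)\<^sup>2)"
      by (intro Bochner_Integration.integral_nonneg) simp
    also have "\<dots> = (LBINT l. (\<Sum>i<n. \<Sum>j<n. c i * c j * (\<phi> (x i) l * \<phi> (x j) l)))"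
      by (simp add: power2_eq_square sum_product mult_ac)
    also have "\<dots> = (\<Sum>i<n. \<Sum>j<n. c i * c j * K (x i) (x j))"
      using int by (simp add: K_def)
    finally show ?thesis .
  qed
  have sym: "K (x i) (x j) = K (x j) (x i)" for i j by (simp add: K_def mult.commute)
  show "0 \<le> kernel_det K n x" "kernel_det K n x \<le> (\<Prod>i<n. K (x i) (x i))"
    unfolding kernel_det_def using Hadamard_psd[of n "\<lambda>i j. K (x i) (x j)", OF sym psd] by auto
qed

text \<open>Conjugation by a diagonal matrix: in each Leibniz term every \<open>a (x i)\<close>
  occurs once through its row and once through its column. It serves both for the square-root
  weights on the Airy kernel and for the indicators that restrict \<open>M_kernel\<close>.\<close>

lemma kernel_det_scale:
  "kernel_det (\<lambda>x y. a x * a y * K x y) n x = (\<Prod>i<n. (a (x i))\<^sup>2) * kernel_det K n x"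
proof -
  have "(\<Prod>i<n. a (x i) * a (x (p i)) * K (x i) (x (p i))) = (\<Prod>i<n. (a (x i))\<^sup>2) * (\<Prod>i<n. K (x i) (x (p i)))"
    if "p permutes {..<n}" for p
    using prod.permute[OF that, of "\<lambda>i. a (x i)"]
    by (simp add: prod.distrib power2_eq_square o_def)
  then show ?thesis
    unfolding kernel_det_def det_permutation_sum sum_distrib_left
    by (intro sum.cong) (auto simp: mult_ac)
qed

text \<open>The determinant whose squared double integral is common to both Fredholm terms. Rows are
  indexed by \<open>l\<close>, the order in which \<open>Andreief\<close> integrates; transposition
  exchanges the roles of \<open>x\<close> and \<open>l\<close>.\<close>

definition Slater :: "(real \<Rightarrow> real \<Rightarrow> real) \<Rightarrow> nat \<Rightarrow> (nat \<Rightarrow> real) \<Rightarrow> (nat \<Rightarrow> real) \<Rightarrow> real" where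
  "Slater \<phi> n x l = Determinant.det (Matrix.mat n n (\<lambda>(k, i). \<phi> (x i) (l k)))"

lemma Slater_flip: "Slater \<phi> n x l = Slater (\<lambda>a b. \<phi> b a) n l x"
  unfolding Slater_def by (rule det_mat_transpose)

lemma Slater_measurable [measurable]:
  fixes \<phi> :: "real \<Rightarrow> real \<Rightarrow> real"
  assumes "(\<lambda>(x, l). \<phi> x l) \<in> borel_measurable (borel \<Otimes>\<^sub>M borel)"
  shows "(\<lambda>(x, l). Slater \<phi> n x l) \<in>
    borel_measurable (Pi\<^sub>M {..<n} (\<lambda>_. lborel) \<Otimes>\<^sub>M Pi\<^sub>M {..<n} (\<lambda>_. lborel))"
proof -
  let ?N = "Pi\<^sub>M {..<n} (\<lambda>_. lborel :: real measure)"
  have component: "(\<lambda>x. x i) \<in> borel_measurable ?N" if "i < n" for i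
    using measurable_component_singleton[of i "{..<n}" "\<lambda>_. lborel :: real measure"] that by simp
  have "(\<lambda>z. \<phi> (fst z i) (snd z j)) \<in> borel_measurable (?N \<Otimes>\<^sub>M ?N)" if "i < n" "j < n" for i j
    using measurable_compose[OF measurable_Pair[OF measurable_compose[OF measurable_fst component[OF that(1)]]
          measurable_compose[OF measurable_snd component[OF that(2)]]] assms] by simp
  then show ?thesis
    unfolding Slater_def det_permutation_sum unfolding case_prod_unfold
    by (intro borel_measurable_sum borel_measurable_times borel_measurable_const borel_measurable_prod)
      (auto dest: permutes_in_image)
qed

lemma kernel_det_eq_nn_integral_Slater:
  fixes \<phi> :: "real \<Rightarrow> real \<Rightarrow> real"
  assumes "\<And>x y. integrable lborel (\<lambda>l. \<phi> x l * \<phi> y l)"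
  shows "ennreal (kernel_det (\<lambda>x y. LBINT l. \<phi> x l * \<phi> y l) n x) =
    ennreal (1 / fact n) * (\<integral>\<^sup>+ l. ennreal ((Slater \<phi> n x l)\<^sup>2) \<partial>Pi\<^sub>M {..<n} (\<lambda>_. lborel))"
proof -
  have "ennreal (1 / fact n) * (\<integral>\<^sup>+ l. ennreal ((Slater \<phi> n x l)\<^sup>2) \<partial>Pi\<^sub>M {..<n} (\<lambda>_. lborel))
      = ennreal (1 / fact n) * ennreal (fact n * kernel_det (\<lambda>x y. LBINT l. \<phi> x l * \<phi> y l) n x)"
    unfolding Slater_def kernel_det_def by (subst Andreief) (auto intro: assms)
  also have "\<dots> = ennreal (kernel_det (\<lambda>x y. LBINT l. \<phi> x l * \<phi> y l) n x)"
    by (subst ennreal_mult'[symmetric]) (auto intro: kernel_det_Gram assms)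
  finally show ?thesis ..
qed

text \<open>Measurability is inherited from the partial integral of the squared Slater determinant;
  passing through \<open>ennreal\<close> loses nothing because a Gram determinant is
  nonnegative.\<close>

lemma kernel_det_Gram_measurable:
  fixes \<phi> :: "real \<Rightarrow> real \<Rightarrow> real"
  assumes meas [measurable]: "(\<lambda>(x, l). \<phi> x l) \<in> borel_measurable (borel \<Otimes>\<^sub>M borel)"
    and int: "\<And>x y. integrable lborel (\<lambda>l. \<phi> x l * \<phi> y l)"
  shows "kernel_det (\<lambda>x y. LBINT l. \<phi> x l * \<phi> y l) n \<in> borel_measurable (Pi\<^sub>M {..<n} (\<lambda>_. lborel))"
proof -
  let ?K = "\<lambda>x y. LBINT l. \<phi> x l * \<phi> y l"
  interpret N: sigma_finite_measure "Pi\<^sub>M {..<n} (\<lambda>_. lborel :: real measure)"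
    by (rule lborel_product.sigma_finite) simp
  have "(\<lambda>x. enn2real (ennreal (kernel_det ?K n x))) \<in> borel_measurable (Pi\<^sub>M {..<n} (\<lambda>_. lborel))"
    unfolding kernel_det_eq_nn_integral_Slater[OF int] by measurable
  then show ?thesis using int by (simp add: kernel_det_Gram(1))
qed

text \<open>The identity of Fredholm determinants \<open>det (I - B B\<^sup>T) = det (I - B\<^sup>T B)\<close>, term by term.\<close>

theorem kernel_det_swap:
  fixes \<phi> :: "real \<Rightarrow> real \<Rightarrow> real"
  assumes meas [measurable]: "(\<lambda>(x, l). \<phi> x l) \<in> borel_measurable (borel \<Otimes>\<^sub>M borel)"
    and int1: "\<And>x y. integrable lborel (\<lambda>l. \<phi> x l * \<phi> y l)"
    and int2: "\<And>l m. integrable lborel (\<lambda>x. \<phi> x l * \<phi> x m)"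
  shows "(\<integral>\<^sup>+ x. ennreal (kernel_det (\<lambda>x y. LBINT l. \<phi> x l * \<phi> y l) n x) \<partial>Pi\<^sub>M {..<n} (\<lambda>_. lborel)) =
    (\<integral>\<^sup>+ l. ennreal (kernel_det (\<lambda>l m. LBINT x. \<phi> x l * \<phi> x m) n l) \<partial>Pi\<^sub>M {..<n} (\<lambda>_. lborel))"
    (is "?L = ?R")
proof -
  let ?N = "Pi\<^sub>M {..<n} (\<lambda>_. lborel :: real measure)"
  interpret N: sigma_finite_measure ?N by (rule lborel_product.sigma_finite) simp
  interpret NN: pair_sigma_finite ?N ?N ..
  have "?L = ennreal (1 / fact n) * (\<integral>\<^sup>+ x. \<integral>\<^sup>+ l. ennreal ((Slater \<phi> n x l)\<^sup>2) \<partial>?N \<partial>?N)"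
    unfolding kernel_det_eq_nn_integral_Slater[OF int1] by (rule nn_integral_cmult) measurable
  also have "(\<integral>\<^sup>+ x. \<integral>\<^sup>+ l. ennreal ((Slater \<phi> n x l)\<^sup>2) \<partial>?N \<partial>?N) =
      (\<integral>\<^sup>+ l. \<integral>\<^sup>+ x. ennreal ((Slater \<phi> n x l)\<^sup>2) \<partial>?N \<partial>?N)"
    by (rule NN.Fubini'[symmetric]) measurable
  also have "ennreal (1 / fact n) * \<dots> = ?R"
    unfolding kernel_det_eq_nn_integral_Slater[of "\<lambda>l x. \<phi> x l", OF int2] Slater_flip[of \<phi>, symmetric]
    by (rule nn_integral_cmult[symmetric]) measurable
  finally show ?thesis .
qed

section \<open>The factor of the Airy kernel\<close>

text \<open>One constant for both tails. Quadratic growth is far from sharp but enough, since it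
  will meet an exponentially small weight. On \<open>[0, 1]\<close> the decay follows from growth
  with \<open>1 + u\<^sup>2 \<le> 2\<close>, giving \<open>8 * A\<close>; beyond 1 it follows from
  \<open>52 / u\<^sup>2\<close> and \<open>1 + u\<^sup>2 \<le> 2 * u\<^sup>2\<close>, giving
  104.\<close>

lemma Airy_square_bounds:
  "\<exists>C>0. (\<forall>u\<ge>0. (Airy_Ai u)\<^sup>2 * (1 + u\<^sup>2)\<^sup>2 \<le> C) \<and> (\<forall>u. (Airy_Ai u)\<^sup>2 \<le> C * (1 + u\<^sup>2))"
proof -
  \<comment> \<open>With \<open>s = sqrt (1 + u\<^sup>2) \<ge> 1\<close>, the bound
    \<open>1 + 3 * (2 * s) + 52 * pi\<close> is at most \<open>(7 + 52 * pi) * s\<close>.\<close>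
  define A where "A = (7 + 52 * pi)\<^sup>2"
  have growth: "(Airy_Ai u)\<^sup>2 \<le> A * (1 + u\<^sup>2)" for u
  proof -
    define s where "s = sqrt (1 + u\<^sup>2)"
    have s: "1 \<le> s" "s\<^sup>2 = 1 + u\<^sup>2" by (auto simp: s_def)
    have "\<bar>u\<bar> \<le> s" by (simp add: s_def real_le_rsqrt)
    then have "2 * \<bar>u\<bar> + 2 \<le> 4 * s" using s by linarith
    also have "\<dots> \<le> (2 * s)\<^sup>2" using s(1) by (simp add: power2_eq_square)
    finally have "sqrt (2 * \<bar>u\<bar> + 2) \<le> 2 * s" using s(1) by (intro real_le_lsqrt) auto
    then have "\<bar>pi * Airy_Ai u\<bar> \<le> 1 + 3 * (2 * s) + 52 * pi"
      using Airy_integrable_bound[of u] by linarith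
    also have "\<dots> \<le> (7 + 52 * pi) * s"
      using s(1) mult_left_mono[OF s(1), of "1 + 52 * pi"] by (simp add: algebra_simps)
    finally have "pi * \<bar>Airy_Ai u\<bar> \<le> (7 + 52 * pi) * s" by (simp add: abs_mult)
    moreover have "\<bar>Airy_Ai u\<bar> \<le> pi * \<bar>Airy_Ai u\<bar>"
      using pi_gt3 by (simp add: mult_le_cancel_right1)
    ultimately have "\<bar>Airy_Ai u\<bar> \<le> (7 + 52 * pi) * s" by linarith
    then have "\<bar>Airy_Ai u\<bar>\<^sup>2 \<le> ((7 + 52 * pi) * s)\<^sup>2" by (intro power_mono) auto
    then show ?thesis by (simp add: power_mult_distrib s(2) A_def)
  qed
  have decay: "(Airy_Ai u)\<^sup>2 * (1 + u\<^sup>2)\<^sup>2 \<le> max (8 * A) (104\<^sup>2)" if "0 \<le> u" for u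
  proof (cases "u \<le> 1")
    case True
    then have "u\<^sup>2 \<le> 1" using that by (simp add: power_le_one)
    have "(Airy_Ai u)\<^sup>2 * (1 + u\<^sup>2)\<^sup>2 \<le> A * (1 + u\<^sup>2) * (1 + u\<^sup>2)\<^sup>2"
      using growth by (intro mult_right_mono) auto
    also have "\<dots> = A * (1 + u\<^sup>2) ^ 3" by (simp add: power3_eq_cube power2_eq_square)
    also have "\<dots> \<le> A * 2 ^ 3"
      using \<open>u\<^sup>2 \<le> 1\<close> by (intro mult_left_mono power_mono) (auto simp: A_def)
    finally show ?thesis by simp
  next
    case False
    then have u: "1 \<le> u" by simp
    have u2: "1 \<le> u\<^sup>2" using u by simp
    have "\<bar>Airy_Ai u\<bar> * (1 + u\<^sup>2) \<le> (52 / u\<^sup>2) * (2 * u\<^sup>2)"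
      using Airy_decay[OF u] u2 by (intro mult_mono) auto
    also have "\<dots> = 104" using u by simp
    finally have "(\<bar>Airy_Ai u\<bar> * (1 + u\<^sup>2))\<^sup>2 \<le> 104\<^sup>2"
      by (intro power_mono) auto
    then show ?thesis by (simp add: power_mult_distrib)
  qed
  show ?thesis
  proof (intro exI[of _ "max (8 * A) (104\<^sup>2)"] conjI allI impI decay)
    fix u
    have "A * (1 + u\<^sup>2) \<le> max (8 * A) (104\<^sup>2) * (1 + u\<^sup>2)"
      by (intro mult_right_mono) (auto simp: A_def)
    then show "(Airy_Ai u)\<^sup>2 \<le> max (8 * A) (104\<^sup>2) * (1 + u\<^sup>2)" using growth[of u] by linarith
  qed auto
qed

text \<open>The shift by \<xi> lets \<open>l\<close> range over the interval on which
  \<open>F_dist\<close> is defined. The substitution \<open>l = \<xi> + \<lambda>\<close> gives back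
  the Airy kernel, and \<open>x = \<xi> + \<lambda>\<close> gives \<open>M_kernel\<close>.\<close>

definition Airy_factor :: "real \<Rightarrow> real \<Rightarrow> real \<Rightarrow> real \<Rightarrow> real" where
  "Airy_factor \<alpha> \<xi> x l = sqrt (1 - G_dist \<alpha> (\<xi> - x)) * Airy_Ai (x + l - \<xi>) * indicator {\<xi><..} l"

lemma one_minus_G_dist: "1 - G_dist \<alpha> x = 1 / (1 + exp (\<alpha> * x))"
  by (simp add: G_dist_def field_simps add_pos_pos add_nonneg_eq_0_iff)

lemma G_dist_bounds: "0 \<le> 1 - G_dist \<alpha> x" "1 - G_dist \<alpha> x \<le> 1" "0 \<le> G_dist \<alpha> x" "G_dist \<alpha> x \<le> 1"
  by (auto simp: one_minus_G_dist G_dist_def field_simps add_pos_pos)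

lemma G_dist_measurable [measurable]: "G_dist \<alpha> \<in> borel_measurable borel"
  unfolding G_dist_def by measurable

lemma Airy_factor_measurable [measurable]:
  "(\<lambda>(x, l). Airy_factor \<alpha> \<xi> x l) \<in> borel_measurable (borel \<Otimes>\<^sub>M borel)"
  unfolding Airy_factor_def by measurable

text \<open>With \<open>u = x + l - \<xi>\<close>, which exceeds \<open>x\<close> on the support,
  the majorant is a product of Cauchy densities in \<open>x\<close> and \<open>u\<close> up to
  constants. It yields integrability in each variable separately and in both jointly.\<close>

lemma Airy_factor_bound:
  assumes \<alpha>: "\<alpha> > 0"
  shows "\<exists>C. \<forall>x l. (Airy_factor \<alpha> \<xi> x l)\<^sup>2 \<le> C / ((1 + x\<^sup>2) * (1 + (x + l - \<xi>)\<^sup>2))"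
proof -
  obtain C where C: "C > 0" "\<And>u. u \<ge> 0 \<Longrightarrow> (Airy_Ai u)\<^sup>2 * (1 + u\<^sup>2)\<^sup>2 \<le> C" "\<And>u. (Airy_Ai u)\<^sup>2 \<le> C * (1 + u\<^sup>2)"
    using Airy_square_bounds by blast
  let ?g = "\<lambda>x. 1 - G_dist \<alpha> (\<xi> - x)"
  \<comment> \<open>The weight decays exponentially at minus infinity and beats any polynomial;
    between \<open>N\<close> and 0 it is at most 1. The third power covers the growth of the squared
    Airy function and both target factors in the worst region below.\<close>
  obtain B where B: "B \<ge> 1" "\<And>x. x \<le> 0 \<Longrightarrow> ?g x * (1 + x\<^sup>2) ^ 3 \<le> B"
  proof -
    have "((\<lambda>x. (1 + x\<^sup>2) ^ 3 / (1 + exp (\<alpha> * (\<xi> - x)))) \<longlongrightarrow> 0) at_bot"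
      using \<alpha> by real_asymp
    then have "eventually (\<lambda>x. (1 + x\<^sup>2) ^ 3 / (1 + exp (\<alpha> * (\<xi> - x))) < 1) at_bot"
      by (rule order_tendstoD) simp
    then obtain N where N: "\<And>x. x \<le> N \<Longrightarrow> (1 + x\<^sup>2) ^ 3 / (1 + exp (\<alpha> * (\<xi> - x))) < 1"
      by (auto simp: eventually_at_bot_linorder)
    show ?thesis
    proof (rule that)
      fix x :: real assume "x \<le> 0"
      show "?g x * (1 + x\<^sup>2) ^ 3 \<le> (1 + N\<^sup>2) ^ 3"
      proof (cases "x \<le> N")
        case True
        have "?g x * (1 + x\<^sup>2) ^ 3 \<le> 1" using N[OF True] by (simp add: one_minus_G_dist)
        also have "1 \<le> (1 + N\<^sup>2) ^ 3" by (intro one_le_power) auto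
        finally show ?thesis .
      next
        case False
        then have "x\<^sup>2 \<le> N\<^sup>2" using \<open>x \<le> 0\<close> by (intro abs_le_square_iff[THEN iffD1]) auto
        then have "?g x * (1 + x\<^sup>2) ^ 3 \<le> 1 * (1 + N\<^sup>2) ^ 3"
          using G_dist_bounds[of \<alpha> "\<xi> - x"] by (intro mult_mono power_mono) auto
        then show ?thesis by simp
      qed
    qed (intro one_le_power, auto)
  qed
  have "?g x * (Airy_Ai u)\<^sup>2 * ((1 + x\<^sup>2) * (1 + u\<^sup>2)) \<le> C * B" if "x < u" for x u
  proof -
    have g: "0 \<le> ?g x" "?g x \<le> 1" using G_dist_bounds by auto
    have X: "1 \<le> 1 + x\<^sup>2" and U: "1 \<le> 1 + u\<^sup>2" by auto
    \<comment> \<open>For \<open>x < u < 0\<close> the weight absorbs everything. For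
      \<open>\<bar>x\<bar> \<le> u\<close> the decay of the Airy function suffices. For
      \<open>x < - u \<le> 0\<close> the weight handles the factor in \<open>x\<close> and the Airy
      function the factor in \<open>u\<close>.\<close>
    consider "u < 0" | "0 \<le> u" "\<bar>x\<bar> \<le> u" | "0 \<le> u" "x < - u" using \<open>x < u\<close> by linarith
    then show ?thesis
    proof cases
      case 1
      have "u\<^sup>2 \<le> x\<^sup>2" using 1 \<open>x < u\<close> by (intro abs_le_square_iff[THEN iffD1]) auto
      have "(Airy_Ai u)\<^sup>2 * (1 + u\<^sup>2) \<le> C * (1 + u\<^sup>2) * (1 + u\<^sup>2)"
        using C(3) by (intro mult_right_mono) auto
      also have "\<dots> \<le> C * (1 + x\<^sup>2) * (1 + x\<^sup>2)"
        using C(1) \<open>u\<^sup>2 \<le> x\<^sup>2\<close> by (intro mult_mono) auto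
      finally have "?g x * (1 + x\<^sup>2) * ((Airy_Ai u)\<^sup>2 * (1 + u\<^sup>2)) \<le> ?g x * (1 + x\<^sup>2) * (C * (1 + x\<^sup>2) * (1 + x\<^sup>2))"
        using g by (intro mult_left_mono) auto
      also have "\<dots> = C * (?g x * (1 + x\<^sup>2) ^ 3)" by (simp add: power3_eq_cube)
      also have "\<dots> \<le> C * B" using B(2) C(1) 1 \<open>x < u\<close> by (intro mult_left_mono) auto
      finally show ?thesis by (simp add: mult_ac)
    next
      case 2
      have "x\<^sup>2 \<le> u\<^sup>2" using 2 by (intro abs_le_square_iff[THEN iffD1]) auto
      have "?g x * (Airy_Ai u)\<^sup>2 * ((1 + x\<^sup>2) * (1 + u\<^sup>2)) \<le> 1 * (Airy_Ai u)\<^sup>2 * ((1 + u\<^sup>2) * (1 + u\<^sup>2))"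
        using g \<open>x\<^sup>2 \<le> u\<^sup>2\<close> by (intro mult_mono) auto
      also have "\<dots> \<le> C * 1" using C(2)[OF 2(1)] by (simp add: power2_eq_square)
      also have "\<dots> \<le> C * B" using B(1) C(1) by (intro mult_left_mono) auto
      finally show ?thesis .
    next
      case 3
      have "(Airy_Ai u)\<^sup>2 * (1 + u\<^sup>2) * 1 \<le> (Airy_Ai u)\<^sup>2 * (1 + u\<^sup>2) * (1 + u\<^sup>2)"
        by (intro mult_left_mono) auto
      also have "\<dots> \<le> C" using C(2)[OF 3(1)] by (simp add: power2_eq_square mult_ac)
      finally have a: "(Airy_Ai u)\<^sup>2 * (1 + u\<^sup>2) \<le> C" by simp
      have "(1 + x\<^sup>2) ^ 1 \<le> (1 + x\<^sup>2) ^ 3" by (intro power_increasing) auto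
      then have "?g x * (1 + x\<^sup>2) \<le> ?g x * (1 + x\<^sup>2) ^ 3" using g by (intro mult_left_mono) auto
      also have "\<dots> \<le> B" using 3 by (intro B(2)) auto
      finally have b: "?g x * (1 + x\<^sup>2) \<le> B" .
      have "((Airy_Ai u)\<^sup>2 * (1 + u\<^sup>2)) * (?g x * (1 + x\<^sup>2)) \<le> C * B"
        using a b g C(1) by (intro mult_mono) auto
      then show ?thesis by (simp add: mult_ac)
    qed
  qed
  then have main: "?g x * (Airy_Ai u)\<^sup>2 \<le> C * B / ((1 + x\<^sup>2) * (1 + u\<^sup>2))" if "x < u" for x u
    using that by (subst pos_le_divide_eq) (auto intro!: mult_pos_pos add_pos_nonneg)
  show ?thesis
  proof (intro exI allI)
    fix x l
    show "(Airy_factor \<alpha> \<xi> x l)\<^sup>2 \<le> (C * B) / ((1 + x\<^sup>2) * (1 + (x + l - \<xi>)\<^sup>2))"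
    proof (cases "l > \<xi>")
      case True
      then have "(Airy_factor \<alpha> \<xi> x l)\<^sup>2 = ?g x * (Airy_Ai (x + l - \<xi>))\<^sup>2"
        using G_dist_bounds by (simp add: Airy_factor_def power_mult_distrib)
      then show ?thesis using main[of x "x + l - \<xi>"] True by simp
    next
      case False
      then show ?thesis using B(1) C(1) by (simp add: Airy_factor_def)
    qed
  qed
qed

lemma Cauchy_integrable: "integrable lborel (\<lambda>x::real. 1 / (1 + (x + c)\<^sup>2))"
proof -
  have "integrable lborel (\<lambda>x::real. inverse (1 + x\<^sup>2))"
    using integrable_inverse_1_plus_square by (simp add: set_integrable_def)
  then have "integrable lborel (\<lambda>x::real. inverse (1 + (c + 1 * x)\<^sup>2))"
    by (rule lborel_integrable_real_affine) simp
  then show ?thesis by (simp add: divide_inverse add.commute)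
qed

lemma Airy_factor_square_integrable:
  assumes \<alpha>: "\<alpha> > 0"
  shows "integrable lborel (\<lambda>l. (Airy_factor \<alpha> \<xi> x l)\<^sup>2)"
    and "integrable lborel (\<lambda>x. (Airy_factor \<alpha> \<xi> x l)\<^sup>2)"
proof -
  obtain C where C: "\<And>x l. (Airy_factor \<alpha> \<xi> x l)\<^sup>2 \<le> C / ((1 + x\<^sup>2) * (1 + (x + l - \<xi>)\<^sup>2))"
    using Airy_factor_bound[OF \<alpha>] by blast
  \<comment> \<open>The bound at \<open>x = l = 0\<close> already forces the constant to be
    nonnegative.\<close>
  have "0 \<le> C \<or> C \<le> 0 \<and> 1 + \<xi>\<^sup>2 \<le> 0"
    using order_trans[OF zero_le_power2 C[of 0 0]] by (simp add: zero_le_divide_iff)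
  then have nonneg: "0 \<le> C" using zero_le_power2[of \<xi>] by argo
  have "C / (a * b) \<le> C * (1 / a)" if "1 \<le> a" "1 \<le> b" for a b :: real
    using that nonneg divide_left_mono[of a "a * b" C] by (simp add: mult_le_cancel_left1)
  then have bound: "C / ((1 + x\<^sup>2) * (1 + (x + l - \<xi>)\<^sup>2)) \<le> C * (1 / (1 + x\<^sup>2))"
    "C / ((1 + x\<^sup>2) * (1 + (x + l - \<xi>)\<^sup>2)) \<le> C * (1 / (1 + (x + l - \<xi>)\<^sup>2))" for x l
    by (simp, subst mult.commute, simp)
  show "integrable lborel (\<lambda>l. (Airy_factor \<alpha> \<xi> x l)\<^sup>2)"
  proof (rule Bochner_Integration.integrable_bound)
    show "integrable lborel (\<lambda>l. C * (1 / (1 + (l + (x - \<xi>))\<^sup>2)))"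
      by (intro integrable_mult_right Cauchy_integrable)
    show "AE l in lborel. norm ((Airy_factor \<alpha> \<xi> x l)\<^sup>2) \<le> norm (C * (1 / (1 + (l + (x - \<xi>))\<^sup>2)))"
      using order_trans[OF C bound(2), of x] nonneg by (simp add: algebra_simps)
  qed simp
  show "integrable lborel (\<lambda>x. (Airy_factor \<alpha> \<xi> x l)\<^sup>2)"
  proof (rule Bochner_Integration.integrable_bound)
    show "integrable lborel (\<lambda>x. C * (1 / (1 + (x + 0)\<^sup>2)))"
      by (intro integrable_mult_right Cauchy_integrable)
    show "AE x in lborel. norm ((Airy_factor \<alpha> \<xi> x l)\<^sup>2) \<le> norm (C * (1 / (1 + (x + 0)\<^sup>2)))"
      using order_trans[OF C bound(1), of _ l] nonneg by simp
  qed simp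
qed

text \<open>This double integral is the squared Hilbert-Schmidt norm of the factor, that is, the
  trace of its Gram kernel. After translating \<open>l\<close> the majorant integrates to a product
  of two Cauchy integrals.\<close>

lemma Airy_factor_trace_finite:
  assumes \<alpha>: "\<alpha> > 0"
  shows "(\<integral>\<^sup>+ x. \<integral>\<^sup>+ l. ennreal ((Airy_factor \<alpha> \<xi> x l)\<^sup>2) \<partial>lborel \<partial>lborel) < \<infinity>"
proof -
  obtain C where C: "\<And>x l. (Airy_factor \<alpha> \<xi> x l)\<^sup>2 \<le> C / ((1 + x\<^sup>2) * (1 + (x + l - \<xi>)\<^sup>2))"
    using Airy_factor_bound[OF \<alpha>] by blast
  define c where "c = (\<integral>\<^sup>+ x. ennreal (1 / (1 + x\<^sup>2)) \<partial>lborel)"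
  have c: "c < \<infinity>"
    using Cauchy_integrable[of 0] by (simp add: c_def integrable_iff_bounded)
  have shift: "(\<integral>\<^sup>+ l. ennreal (1 / (1 + (x + l - \<xi>)\<^sup>2)) \<partial>lborel) = c" for x
    unfolding c_def
    by (subst nn_integral_real_affine[of _ 1 "x - \<xi>"]) (auto simp: algebra_simps)
  have "(\<integral>\<^sup>+ x. \<integral>\<^sup>+ l. ennreal ((Airy_factor \<alpha> \<xi> x l)\<^sup>2) \<partial>lborel \<partial>lborel)
      \<le> (\<integral>\<^sup>+ x. \<integral>\<^sup>+ l. ennreal \<bar>C\<bar> * ennreal (1 / (1 + x\<^sup>2)) * ennreal (1 / (1 + (x + l - \<xi>)\<^sup>2)) \<partial>lborel \<partial>lborel)"
  proof (intro nn_integral_mono)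
    fix x l
    have "(Airy_factor \<alpha> \<xi> x l)\<^sup>2 \<le> \<bar>C\<bar> * (1 / (1 + x\<^sup>2)) * (1 / (1 + (x + l - \<xi>)\<^sup>2))"
      using C[of x l] by (rule order_trans) (auto intro!: divide_right_mono)
    then show "ennreal ((Airy_factor \<alpha> \<xi> x l)\<^sup>2)
        \<le> ennreal \<bar>C\<bar> * ennreal (1 / (1 + x\<^sup>2)) * ennreal (1 / (1 + (x + l - \<xi>)\<^sup>2))"
      by (simp add: ennreal_mult'[symmetric] ennreal_leI)
  qed
  also have "\<dots> = (\<integral>\<^sup>+ x. ennreal \<bar>C\<bar> * ennreal (1 / (1 + x\<^sup>2)) * c \<partial>lborel)"
    by (subst nn_integral_cmult) (auto simp: shift)
  also have "\<dots> = ennreal \<bar>C\<bar> * c * c"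
    by (simp add: nn_integral_multc nn_integral_cmult c_def mult.assoc)
  also have "\<dots> < \<infinity>" using c by (simp add: ennreal_mult_less_top)
  finally show ?thesis .
qed

lemma Airy_factor_integrable:
  assumes "\<alpha> > 0"
  shows "integrable lborel (\<lambda>l. Airy_factor \<alpha> \<xi> x l * Airy_factor \<alpha> \<xi> y l)"
    and "integrable lborel (\<lambda>z. Airy_factor \<alpha> \<xi> z x * Airy_factor \<alpha> \<xi> z y)"
  using Airy_factor_square_integrable[OF assms]
  by (intro integrable_mult_square; measurable)+

lemma Airy_factor_Gram_left:
  "(LBINT l. Airy_factor \<alpha> \<xi> x l * Airy_factor \<alpha> \<xi> y l) =
    sqrt (1 - G_dist \<alpha> (\<xi> - x)) * sqrt (1 - G_dist \<alpha> (\<xi> - y)) * Airy_kernel x y"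
proof -
  have "(LBINT l. Airy_factor \<alpha> \<xi> x l * Airy_factor \<alpha> \<xi> y l) =
      (LBINT l. Airy_factor \<alpha> \<xi> x (\<xi> + 1 * l) * Airy_factor \<alpha> \<xi> y (\<xi> + 1 * l))"
    by (subst lborel_integral_real_affine[where c = 1 and t = \<xi>]) auto
  also have "\<dots> = (LBINT l. (sqrt (1 - G_dist \<alpha> (\<xi> - x)) * sqrt (1 - G_dist \<alpha> (\<xi> - y))) *
      (indicator {0<..} l * (Airy_Ai (x + l) * Airy_Ai (y + l))))"
    by (intro Bochner_Integration.integral_cong) (auto simp: Airy_factor_def indicator_def algebra_simps)
  also have "\<dots> = sqrt (1 - G_dist \<alpha> (\<xi> - x)) * sqrt (1 - G_dist \<alpha> (\<xi> - y)) * Airy_kernel x y"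
    by (subst integral_mult_right_zero) (simp add: Airy_kernel_def set_lebesgue_integral_def)
  finally show ?thesis .
qed

text \<open>Here the logistic law enters: after \<open>x = \<xi> + \<lambda>\<close> the squared
  weight is \<open>1 - G_dist \<alpha> (- \<lambda>)\<close>, which is exactly the weight in
  \<open>M_kernel\<close>.\<close>

lemma Airy_factor_Gram_right:
  "(LBINT x. Airy_factor \<alpha> \<xi> x l * Airy_factor \<alpha> \<xi> x m) =
    indicator {\<xi><..} l * indicator {\<xi><..} m * M_kernel \<alpha> l m"
proof -
  have "(LBINT x. Airy_factor \<alpha> \<xi> x l * Airy_factor \<alpha> \<xi> x m) =
      (LBINT x. Airy_factor \<alpha> \<xi> (\<xi> + 1 * x) l * Airy_factor \<alpha> \<xi> (\<xi> + 1 * x) m)"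
    by (subst lborel_integral_real_affine[where c = 1 and t = \<xi>]) auto
  also have "\<dots> = (LBINT x. (indicator {\<xi><..} l * indicator {\<xi><..} m) *
      (exp (\<alpha> * x) / (exp (\<alpha> * x) + 1) * Airy_Ai (l + x) * Airy_Ai (m + x)))"
  proof (intro Bochner_Integration.integral_cong refl)
    fix x :: real
    define s where "s = sqrt (1 - G_dist \<alpha> (\<xi> - (\<xi> + 1 * x)))"
    have "s * s = 1 - G_dist \<alpha> (\<xi> - (\<xi> + 1 * x))"
      unfolding s_def using G_dist_bounds(1) by (rule real_sqrt_mult_self[THEN trans, OF abs_of_nonneg])
    also have "\<dots> = exp (\<alpha> * x) / (exp (\<alpha> * x) + 1)"
      by (simp add: one_minus_G_dist exp_minus field_simps add_pos_pos)
    finally have ss: "exp (\<alpha> * x) / (exp (\<alpha> * x) + 1) = s * s" ..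
    have "Airy_factor \<alpha> \<xi> (\<xi> + 1 * x) k = s * Airy_Ai (k + x) * indicator {\<xi><..} k" for k
      by (simp add: Airy_factor_def s_def add.commute)
    then show "Airy_factor \<alpha> \<xi> (\<xi> + 1 * x) l * Airy_factor \<alpha> \<xi> (\<xi> + 1 * x) m =
        (indicator {\<xi><..} l * indicator {\<xi><..} m) *
        (exp (\<alpha> * x) / (exp (\<alpha> * x) + 1) * Airy_Ai (l + x) * Airy_Ai (m + x))"
      unfolding ss by (simp add: mult_ac)
  qed
  also have "\<dots> = indicator {\<xi><..} l * indicator {\<xi><..} m * M_kernel \<alpha> l m"
    by (subst integral_mult_right_zero) (simp add: M_kernel_def)
  finally show ?thesis .
qed

section \<open>Point processes with independent perturbations\<close>

text \<open>Index tuples of distinct particles. Extensionality outside \<open>{..<n}\<close> makes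
  them match the points of the product space over \<open>{..<n}\<close> one to one.\<close>

definition injective_tuples :: "nat \<Rightarrow> nat set \<Rightarrow> (nat \<Rightarrow> nat) set" where
  "injective_tuples n J = {j \<in> {..<n} \<rightarrow>\<^sub>E J. inj_on j {..<n}}"

lemma countable_injective_tuples: "countable (injective_tuples n J)"
  unfolding injective_tuples_def by (intro countable_subset[OF _ countable_PiE[of "{..<n}" "\<lambda>_. J"]]) auto

lemma finite_injective_tuples: "finite J \<Longrightarrow> finite (injective_tuples n J)"
  unfolding injective_tuples_def by (rule finite_subset[OF _ finite_PiE[of "{..<n}" "\<lambda>_. J"]]) auto

text \<open>Each \<open>n\<close>-element subset of \<open>J\<close> is enumerated by exactly
  \<open>fact n\<close> injective tuples.\<close>

lemma sum_injective_tuples: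
  fixes W :: "nat set \<Rightarrow> 'a::comm_semiring_1"
  assumes J: "finite J"
  shows "(\<Sum>j\<in>injective_tuples n J. W (j ` {..<n})) = of_nat (fact n) * (\<Sum>S | S \<subseteq> J \<and> card S = n. W S)"
proof -
  let ?T = "{S. S \<subseteq> J \<and> card S = n}"
  have fiber: "card {j \<in> injective_tuples n J. j ` {..<n} = S} = fact n" if S: "S \<in> ?T" for S
  proof -
    have finS: "finite S" using S J by (auto intro: finite_subset)
    have "{j \<in> injective_tuples n J. j ` {..<n} = S} = {j \<in> {..<n} \<rightarrow>\<^sub>E S. inj_on j {..<n}}"
    proof (intro equalityI subsetI)
      fix j assume j: "j \<in> {j \<in> {..<n} \<rightarrow>\<^sub>E S. inj_on j {..<n}}"
      then have "j ` {..<n} \<subseteq> S" "card (j ` {..<n}) = card S"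
        using S by (auto simp: card_image PiE_iff)
      then have "j ` {..<n} = S" using finS by (intro card_subset_eq) auto
      then show "j \<in> {j \<in> injective_tuples n J. j ` {..<n} = S}"
        using j S by (auto simp: injective_tuples_def PiE_iff)
    qed (auto simp: injective_tuples_def PiE_iff)
    then show ?thesis
      using card_inj_on_subset_funcset[of "{..<n}" S "{..<n}"] S finS fact_prod_rev[of n, where 'a = nat] by simp
  qed
  have "(\<Sum>j\<in>injective_tuples n J. W (j ` {..<n})) =
      (\<Sum>S\<in>?T. \<Sum>j\<in>{j \<in> injective_tuples n J. j ` {..<n} = S}. W (j ` {..<n}))"
  proof (rule sum.group[symmetric])
    show "(\<lambda>j. j ` {..<n}) ` injective_tuples n J \<subseteq> ?T"
      by (auto simp: injective_tuples_def card_image PiE_iff)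
  qed (use J in \<open>auto intro: finite_injective_tuples\<close>)
  also have "\<dots> = (\<Sum>S\<in>?T. of_nat (fact n) * W S)"
    using fiber by (intro sum.cong) auto
  finally show ?thesis by (simp add: sum_distrib_left)
qed

lemma emeasure_count_space_bij_betw:
  assumes "bij_betw h A B" "A \<subseteq> A'" "B \<subseteq> B'"
  shows "emeasure (count_space A') A = emeasure (count_space B') B"
  using assms bij_betw_finite[OF assms(1)] bij_betw_same_card[OF assms(1)]
  by (simp add: emeasure_count_space)

text \<open>The defining identity of a correlation function says that the image of counting measure
  times \<open>M\<close> under evaluation of the particles at an index tuple has density \<rho>. An
  equality of measures extends from sets to all nonnegative measurable \<open>f\<close>. Since the
  labelling of particles is almost surely injective, injective index tuples correspond to tuples of
  distinct particles.\<close>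

theorem correlation_function_nn_integral:
  fixes X :: "nat \<Rightarrow> 'w \<Rightarrow> real"
  assumes "prob_space M"
    and X [measurable]: "\<And>j. X j \<in> borel_measurable M"
    and inj: "AE \<omega> in M. inj (\<lambda>j. X j \<omega>)"
    and corr: "correlation_function M (\<lambda>\<omega>. range (\<lambda>j. X j \<omega>)) n \<rho>"
    and f [measurable]: "f \<in> borel_measurable (Pi\<^sub>M {..<n} (\<lambda>_. lborel))"
  shows "(\<integral>\<^sup>+ j. \<integral>\<^sup>+ \<omega>. f (\<lambda>i\<in>{..<n}. X (j i) \<omega>) \<partial>M \<partial>count_space (injective_tuples n UNIV)) =
    (\<integral>\<^sup>+ x. ennreal (\<rho> x) * f x \<partial>Pi\<^sub>M {..<n} (\<lambda>_. lborel))"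
proof -
  interpret prob_space M by fact
  let ?I = "injective_tuples n UNIV" and ?N = "Pi\<^sub>M {..<n} (\<lambda>_. lborel :: real measure)"
  interpret C: sigma_finite_measure "count_space ?I"
    by (intro sigma_finite_measure_count_space_countable countable_injective_tuples)
  interpret CM: pair_sigma_finite "count_space ?I" M ..
  define h where "h = (\<lambda>(j, \<omega>). \<lambda>i\<in>{..<n}. X (j i) \<omega>)"
  have h_apply: "h (j, \<omega>) = (\<lambda>i\<in>{..<n}. X (j i) \<omega>)" for j \<omega> by (simp add: h_def)
  have h [measurable]: "h \<in> count_space ?I \<Otimes>\<^sub>M M \<rightarrow>\<^sub>M ?N"
    by (rule measurable_pair_measure_countable1[OF countable_injective_tuples])
      (auto simp: h_apply intro!: measurable_restrict)
  have \<rho> [measurable]: "\<rho> \<in> borel_measurable ?N"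
    using corr by (simp add: correlation_function_def)
  have eq: "distr (count_space ?I \<Otimes>\<^sub>M M) ?N h = density ?N (\<lambda>x. ennreal (\<rho> x))"
  proof (rule measure_eqI)
    fix A assume "A \<in> sets (distr (count_space ?I \<Otimes>\<^sub>M M) ?N h)"
    then have A [measurable]: "A \<in> sets ?N" by simp
    have A_ext: "x \<in> extensional {..<n}" if "x \<in> A" for x
      using sets.sets_into_space[OF A] that by (auto simp: space_PiM PiE_def)
    have "emeasure (distr (count_space ?I \<Otimes>\<^sub>M M) ?N h) A =
        (\<integral>\<^sup>+ z. indicator A (h z) \<partial>(count_space ?I \<Otimes>\<^sub>M M))"
      using nn_integral_distr[OF h, of "indicator A"] by simp
    also have "\<dots> = (\<integral>\<^sup>+ \<omega>. \<integral>\<^sup>+ j. indicator A (h (j, \<omega>)) \<partial>count_space ?I \<partial>M)"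
      by (intro CM.nn_integral_snd[symmetric]) measurable
    also have "\<dots> = (\<integral>\<^sup>+ \<omega>. emeasure (count_space UNIV)
        {x \<in> A. inj_on x {..<n} \<and> x ` {..<n} \<subseteq> range (\<lambda>j. X j \<omega>)} \<partial>M)"
    proof (rule nn_integral_cong_AE, use inj in eventually_elim)
      fix \<omega> assume inj: "inj (\<lambda>j. X j \<omega>)"
      have "(\<integral>\<^sup>+ j. indicator A (h (j, \<omega>)) \<partial>count_space ?I) =
          (\<integral>\<^sup>+ j. indicator {j \<in> ?I. h (j, \<omega>) \<in> A} j \<partial>count_space ?I)"
        by (intro nn_integral_cong) (auto simp: indicator_def)
      also have "\<dots> = emeasure (count_space ?I) {j \<in> ?I. h (j, \<omega>) \<in> A}"
        by (subst nn_integral_indicator) auto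
      also have "\<dots> = emeasure (count_space UNIV)
          {x \<in> A. inj_on x {..<n} \<and> x ` {..<n} \<subseteq> range (\<lambda>j. X j \<omega>)}" (is "_ = emeasure _ ?B")
      proof (rule emeasure_count_space_bij_betw[where h = "\<lambda>j. h (j, \<omega>)"])
        show "bij_betw (\<lambda>j. h (j, \<omega>)) {j \<in> ?I. h (j, \<omega>) \<in> A} ?B"
          unfolding bij_betw_def
        proof
          show "inj_on (\<lambda>j. h (j, \<omega>)) {j \<in> ?I. h (j, \<omega>) \<in> A}"
          proof (rule inj_onI)
            fix j k assume j: "j \<in> {j \<in> ?I. h (j, \<omega>) \<in> A}" and k: "k \<in> {j \<in> ?I. h (j, \<omega>) \<in> A}"
              and eq: "h (j, \<omega>) = h (k, \<omega>)"
            show "j = k"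
            proof (rule extensionalityI[of _ "{..<n}"])
              fix i assume "i \<in> {..<n}"
              then show "j i = k i"
                using fun_cong[OF eq, of i] inj by (auto simp: h_apply dest: injD)
            qed (use j k in \<open>auto simp: injective_tuples_def PiE_iff\<close>)
          qed
          show "(\<lambda>j. h (j, \<omega>)) ` {j \<in> ?I. h (j, \<omega>) \<in> A} = ?B"
          proof (intro equalityI subsetI)
            fix x assume "x \<in> (\<lambda>j. h (j, \<omega>)) ` {j \<in> ?I. h (j, \<omega>) \<in> A}"
            then obtain j where j: "j \<in> ?I" "h (j, \<omega>) \<in> A" "x = h (j, \<omega>)" by auto
            have "inj_on x {..<n}"
              using j inj by (auto simp: h_apply inj_on_def injective_tuples_def)
            then show "x \<in> ?B" using j by (auto simp: h_apply)
          next
            fix x assume x: "x \<in> ?B"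
            then have "\<forall>i\<in>{..<n}. \<exists>k. x i = X k \<omega>" by auto
            then have "\<exists>j0. \<forall>i\<in>{..<n}. x i = X (j0 i) \<omega>" by (rule bchoice)
            then obtain j0 where j0: "\<And>i. i < n \<Longrightarrow> x i = X (j0 i) \<omega>" by auto
            define j where "j = restrict j0 {..<n}"
            have "h (j, \<omega>) = x"
              using A_ext[of x] x j0 by (auto simp: h_apply j_def extensional_def fun_eq_iff)
            moreover have "j \<in> ?I"
              using x j0 by (auto simp: j_def injective_tuples_def inj_on_def)
            ultimately show "x \<in> (\<lambda>j. h (j, \<omega>)) ` {j \<in> ?I. h (j, \<omega>) \<in> A}" using x by force
          qed
        qed
      qed auto
      finally show "(\<integral>\<^sup>+ j. indicator A (h (j, \<omega>)) \<partial>count_space ?I) = emeasure (count_space UNIV) ?B" .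
    qed
    also have "\<dots> = (\<integral>\<^sup>+ x\<in>A. ennreal (\<rho> x) \<partial>?N)"
      using corr A by (simp add: correlation_function_def)
    also have "\<dots> = emeasure (density ?N (\<lambda>x. ennreal (\<rho> x))) A"
      by (simp add: emeasure_density)
    finally show "emeasure (distr (count_space ?I \<Otimes>\<^sub>M M) ?N h) A = emeasure (density ?N (\<lambda>x. ennreal (\<rho> x))) A" .
  qed simp
  have "(\<integral>\<^sup>+ j. \<integral>\<^sup>+ \<omega>. f (\<lambda>i\<in>{..<n}. X (j i) \<omega>) \<partial>M \<partial>count_space ?I) =
      (\<integral>\<^sup>+ z. f (h z) \<partial>(count_space ?I \<Otimes>\<^sub>M M))"
    by (subst nn_integral_fst[symmetric]) (auto simp: h_apply)
  also have "\<dots> = (\<integral>\<^sup>+ x. f x \<partial>distr (count_space ?I \<Otimes>\<^sub>M M) ?N h)"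
    by (simp add: nn_integral_distr)
  also have "\<dots> = (\<integral>\<^sup>+ x. ennreal (\<rho> x) * f x \<partial>?N)"
    unfolding eq by (intro nn_integral_density) measurable
  finally show ?thesis .
qed

text \<open>Conditionally on the \<open>X\<close>, the events \<open>X j + Y j \<le> \<xi>\<close> are independent.\<close>

lemma (in prob_space) prob_all_perturbed_le:
  fixes X Y :: "nat \<Rightarrow> 'a \<Rightarrow> real"
  assumes indep_Y: "indep_vars (\<lambda>_. borel) Y UNIV"
    and cdf_Y: "\<And>j x. cdf (distr M borel (Y j)) x = G x"
    and indep: "indep_var (Pi\<^sub>M UNIV (\<lambda>_. borel)) (\<lambda>\<omega> j. X j \<omega>) (Pi\<^sub>M UNIV (\<lambda>_. borel)) (\<lambda>\<omega> j. Y j \<omega>)"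
    and J: "finite J"
  shows "emeasure M {\<omega> \<in> space M. \<forall>j\<in>J. X j \<omega> + Y j \<omega> \<le> \<xi>} = (\<integral>\<^sup>+ \<omega>. ennreal (\<Prod>j\<in>J. G (\<xi> - X j \<omega>)) \<partial>M)"
proof (cases "J = {}")
  \<comment> \<open>The product rule for independent events is stated for a nonempty index
    set.\<close>
  case True
  then show ?thesis by (simp add: emeasure_space_1)
next
  case False
  let ?S = "Pi\<^sub>M UNIV (\<lambda>_. borel) :: (nat \<Rightarrow> real) measure"
  have Y [measurable]: "Y j \<in> borel_measurable M" for j
    using indep_Y by (auto simp: indep_vars_def)
  have rv: "(\<lambda>\<omega> j. X j \<omega>) \<in> M \<rightarrow>\<^sub>M ?S" "(\<lambda>\<omega> j. Y j \<omega>) \<in> M \<rightarrow>\<^sub>M ?S"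
    and joint: "distr M ?S (\<lambda>\<omega> j. X j \<omega>) \<Otimes>\<^sub>M distr M ?S (\<lambda>\<omega> j. Y j \<omega>) =
      distr M (?S \<Otimes>\<^sub>M ?S) (\<lambda>\<omega>. (\<lambda>j. X j \<omega>, \<lambda>j. Y j \<omega>))"
    using indep unfolding indep_var_distribution_eq by auto
  have proj [measurable]: "(\<lambda>x. x j) \<in> borel_measurable ?S" for j
    by (rule measurable_component_singleton) simp
  interpret DY: prob_space "distr M ?S (\<lambda>\<omega> j. Y j \<omega>)"
    by (rule prob_space_distr) (rule rv)
  define A where "A = {z \<in> space (?S \<Otimes>\<^sub>M ?S). \<forall>j\<in>J. fst z j + snd z j \<le> \<xi>}"
  have A [measurable]: "A \<in> sets (?S \<Otimes>\<^sub>M ?S)"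
    unfolding A_def
  proof (intro sets.sets_Collect_finite_All J)
    fix j
    have [measurable]: "(\<lambda>z. fst z j) \<in> borel_measurable (?S \<Otimes>\<^sub>M ?S)" "(\<lambda>z. snd z j) \<in> borel_measurable (?S \<Otimes>\<^sub>M ?S)"
      by (rule measurable_compose[OF measurable_fst proj] measurable_compose[OF measurable_snd proj])+
    show "{z \<in> space (?S \<Otimes>\<^sub>M ?S). fst z j + snd z j \<le> \<xi>} \<in> sets (?S \<Otimes>\<^sub>M ?S)"
      by measurable
  qed
  have "emeasure M {\<omega> \<in> space M. \<forall>j\<in>J. X j \<omega> + Y j \<omega> \<le> \<xi>} =
      emeasure (distr M (?S \<Otimes>\<^sub>M ?S) (\<lambda>\<omega>. (\<lambda>j. X j \<omega>, \<lambda>j. Y j \<omega>))) A"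
    using rv by (subst emeasure_distr[OF _ A]) (auto simp: A_def space_pair_measure space_PiM intro!: arg_cong[where f = "emeasure M"])
  \<comment> \<open>The joint law is a product, so the probability is an integral over the
    \<open>X\<close>-law of sections that constrain only \<open>Y\<close>.\<close>
  also have "\<dots> = (\<integral>\<^sup>+ x. emeasure (distr M ?S (\<lambda>\<omega> j. Y j \<omega>)) (Pair x -` A) \<partial>distr M ?S (\<lambda>\<omega> j. X j \<omega>))"
    unfolding joint[symmetric] by (rule DY.emeasure_pair_measure_alt) simp
  also have "\<dots> = (\<integral>\<^sup>+ x. ennreal (\<Prod>j\<in>J. G (\<xi> - x j)) \<partial>distr M ?S (\<lambda>\<omega> j. X j \<omega>))"
  proof (rule nn_integral_cong)
    fix x :: "nat \<Rightarrow> real"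
    have marginal: "prob (Y j -` {..\<xi> - x j} \<inter> space M) = G (\<xi> - x j)" for j
      using cdf_Y[of j "\<xi> - x j"] by (simp add: cdf_def measure_distr)
    have "Pair x -` A = {y. \<forall>j\<in>J. y j \<le> \<xi> - x j}"
      by (auto simp: A_def space_pair_measure space_PiM algebra_simps)
    moreover have "Pair x -` A \<in> sets ?S" by (rule sets_Pair1[OF A])
    ultimately have "emeasure (distr M ?S (\<lambda>\<omega> j. Y j \<omega>)) (Pair x -` A) =
        emeasure M {\<omega> \<in> space M. \<forall>j\<in>J. Y j \<omega> \<le> \<xi> - x j}"
      using rv(2) by (subst emeasure_distr) (auto intro!: arg_cong[where f = "emeasure M"])
    also have "{\<omega> \<in> space M. \<forall>j\<in>J. Y j \<omega> \<le> \<xi> - x j} = (\<Inter>j\<in>J. Y j -` {..\<xi> - x j} \<inter> space M)"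
      using False by auto
    also have "emeasure M \<dots> = ennreal (\<Prod>j\<in>J. prob (Y j -` {..\<xi> - x j} \<inter> space M))"
      using False J indep_Y by (subst emeasure_eq_measure, subst indep_varsD[OF indep_Y]) auto
    also have "(\<Prod>j\<in>J. prob (Y j -` {..\<xi> - x j} \<inter> space M)) = (\<Prod>j\<in>J. G (\<xi> - x j))"
      by (simp add: marginal)
    finally show "emeasure (distr M ?S (\<lambda>\<omega> j. Y j \<omega>)) (Pair x -` A) = ennreal (\<Prod>j\<in>J. G (\<xi> - x j))" .
  qed
  also have "\<dots> = (\<integral>\<^sup>+ \<omega>. ennreal (\<Prod>j\<in>J. G (\<xi> - X j \<omega>)) \<partial>M)"
  proof (rule nn_integral_distr[OF rv(1)])
    \<comment> \<open>Nothing is known of \<open>G\<close> except that it is a distribution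
      function; monotonicity makes it measurable.\<close>
    have "mono G"
    proof
      fix a b :: real assume "a \<le> b"
      interpret D: prob_space "distr M borel (Y 0)" by (rule prob_space_distr) simp
      show "G a \<le> G b"
        unfolding cdf_Y[of 0, symmetric] cdf_def using \<open>a \<le> b\<close> by (intro D.finite_measure_mono) auto
    qed
    then have [measurable]: "G \<in> borel_measurable borel" by (rule borel_measurable_mono)
    show "(\<lambda>x. ennreal (\<Prod>j\<in>J. G (\<xi> - x j))) \<in> borel_measurable (distr M ?S (\<lambda>\<omega> j. X j \<omega>))"
      by simp
  qed
  finally show ?thesis .
qed

section \<open>The Fredholm series\<close>

text \<open>Probabilistically the \<open>n\<close>-th factorial moment of the number of perturbed
  particles above \<xi>. Values in \<open>ennreal\<close> allow Tonelli and monotone convergence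
  before finiteness is known.\<close>

definition Airy_moment :: "real \<Rightarrow> real \<Rightarrow> nat \<Rightarrow> ennreal" where
  "Airy_moment \<alpha> \<xi> n = (\<integral>\<^sup>+ x. ennreal (kernel_det (\<lambda>x y. LBINT l. Airy_factor \<alpha> \<xi> x l * Airy_factor \<alpha> \<xi> y l) n x)
     \<partial>Pi\<^sub>M {..<n} (\<lambda>_. lborel))"

text \<open>Hadamard's inequality bounds the determinant by the product of its diagonal entries,
  whose integral is the \<open>n\<close>-th power of the trace \<open>T\<close>.\<close>

lemma Airy_moment_bound:
  assumes \<alpha>: "\<alpha> > 0"
  shows "\<exists>T\<ge>0. \<forall>n. Airy_moment \<alpha> \<xi> n \<le> ennreal (T ^ n)"
proof -
  define t where "t = (\<integral>\<^sup>+ x. \<integral>\<^sup>+ l. ennreal ((Airy_factor \<alpha> \<xi> x l)\<^sup>2) \<partial>lborel \<partial>lborel)"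
  define T where "T = enn2real t"
  have t: "t = ennreal T"
    using Airy_factor_trace_finite[OF \<alpha>, of \<xi>] by (simp add: T_def t_def less_top)
  have "Airy_moment \<alpha> \<xi> n \<le> ennreal (T ^ n)" for n
  proof -
    let ?K = "\<lambda>x y. LBINT l. Airy_factor \<alpha> \<xi> x l * Airy_factor \<alpha> \<xi> y l"
    have diag: "ennreal (?K x x) = (\<integral>\<^sup>+ l. ennreal ((Airy_factor \<alpha> \<xi> x l)\<^sup>2) \<partial>lborel)" for x
      using Airy_factor_square_integrable(1)[OF \<alpha>, of \<xi> x]
      by (subst nn_integral_eq_integral) (auto simp: power2_eq_square)
    have diag0: "0 \<le> ?K x x" for x
      by (intro Bochner_Integration.integral_nonneg) simp
    have "Airy_moment \<alpha> \<xi> n \<le> (\<integral>\<^sup>+ x. (\<Prod>i<n. ennreal (?K (x i) (x i))) \<partial>Pi\<^sub>M {..<n} (\<lambda>_. lborel))"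
      unfolding Airy_moment_def
      by (intro nn_integral_mono, subst prod_ennreal, rule diag0, intro ennreal_leI kernel_det_Gram(2) Airy_factor_integrable \<alpha>)
    also have "\<dots> = (\<Prod>i<n. \<integral>\<^sup>+ x. ennreal (?K x x) \<partial>lborel)"
      unfolding diag by (intro lborel_product.product_nn_integral_prod) auto
    also have "\<dots> = ennreal T ^ n"
      unfolding diag t_def[symmetric] t by simp
    finally show ?thesis by (simp add: T_def ennreal_power)
  qed
  then show ?thesis by (intro exI[of _ T]) (simp add: T_def)
qed

text \<open>Integrating the factor over \<open>x\<close> gives \<open>M_kernel\<close> with an
  indicator on each side. In the determinant these become the indicator of the box, and
  \<open>kernel_det_swap\<close> moves to the Airy side.\<close>

lemma Fredholm_term_eq_Airy_moment:
  assumes \<alpha>: "\<alpha> > 0"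
  shows "(LINT x : (\<Pi>\<^sub>E i\<in>{..<n}. {\<xi><..}) | Pi\<^sub>M {..<n} (\<lambda>_. lborel). kernel_det (M_kernel \<alpha>) n x) =
    enn2real (Airy_moment \<alpha> \<xi> n)"
proof -
  let ?N = "Pi\<^sub>M {..<n} (\<lambda>_. lborel :: real measure)"
  let ?L = "\<lambda>l m. LBINT x. Airy_factor \<alpha> \<xi> x l * Airy_factor \<alpha> \<xi> x m"
  have flip: "(\<lambda>(l, x). Airy_factor \<alpha> \<xi> x l) \<in> borel_measurable (borel \<Otimes>\<^sub>M borel)" by measurable
  have "(LINT x : (\<Pi>\<^sub>E i\<in>{..<n}. {\<xi><..}) | ?N. kernel_det (M_kernel \<alpha>) n x) = (LINT x | ?N. kernel_det ?L n x)"
    unfolding set_lebesgue_integral_def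
  proof (intro Bochner_Integration.integral_cong refl)
    fix x :: "nat \<Rightarrow> real" assume "x \<in> space ?N"
    \<comment> \<open>Membership in the box \<open>PiE\<close> also asks for extensionality, which
      the points of the product space have.\<close>
    then have "x \<in> extensional {..<n}" by (auto simp: space_PiM PiE_def)
    then have "(\<Prod>i<n. (indicator {\<xi><..} (x i))\<^sup>2) = (indicator (\<Pi>\<^sub>E i\<in>{..<n}. {\<xi><..}) x :: real)"
      by (auto simp: indicator_def PiE_iff intro!: prod.neutral prod_zero)
    then show "indicator (\<Pi>\<^sub>E i\<in>{..<n}. {\<xi><..}) x *\<^sub>R kernel_det (M_kernel \<alpha>) n x = kernel_det ?L n x"
      unfolding Airy_factor_Gram_right kernel_det_scale by simp
  qed
  also have "\<dots> = enn2real (\<integral>\<^sup>+ x. ennreal (kernel_det ?L n x) \<partial>?N)"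
    by (intro integral_eq_nn_integral kernel_det_Gram_measurable[OF flip] AE_I2 kernel_det_Gram(1) Airy_factor_integrable \<alpha>)
  also have "(\<integral>\<^sup>+ x. ennreal (kernel_det ?L n x) \<partial>?N) = Airy_moment \<alpha> \<xi> n"
    unfolding Airy_moment_def
    by (intro kernel_det_swap[symmetric] Airy_factor_measurable Airy_factor_integrable \<alpha>)
  finally show ?thesis .
qed

lemma Airy_moment_eq:
  "Airy_moment \<alpha> \<xi> n = (\<integral>\<^sup>+ x. ennreal (kernel_det Airy_kernel n x) * (\<Prod>i<n. ennreal (1 - G_dist \<alpha> (\<xi> - x i)))
    \<partial>Pi\<^sub>M {..<n} (\<lambda>_. lborel))"
  unfolding Airy_moment_def Airy_factor_Gram_left kernel_det_scale
proof (rule nn_integral_cong)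
  fix x :: "nat \<Rightarrow> real"
  have g: "0 \<le> (\<Prod>i<n. 1 - G_dist \<alpha> (\<xi> - x i))"
    by (intro prod_nonneg ballI G_dist_bounds(1))
  have sq: "(sqrt (1 - G_dist \<alpha> t))\<^sup>2 = 1 - G_dist \<alpha> t" for t
    by (intro real_sqrt_pow2 G_dist_bounds(1))
  show "ennreal ((\<Prod>i<n. (sqrt (1 - G_dist \<alpha> (\<xi> - x i)))\<^sup>2) * kernel_det Airy_kernel n x) =
      ennreal (kernel_det Airy_kernel n x) * (\<Prod>i<n. ennreal (1 - G_dist \<alpha> (\<xi> - x i)))"
    unfolding sq ennreal_mult'[OF g] prod_ennreal[OF G_dist_bounds(1)] by (rule mult.commute)
qed

section \<open>Inclusion-exclusion over the first \<open>N\<close> particles and the limit in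
  \<open>N\<close>\<close>

locale perturbed_Airy_process = prob_space M for M :: "'w measure" +
  fixes X Y :: "nat \<Rightarrow> 'w \<Rightarrow> real" and \<alpha> :: real
  assumes \<alpha>: "\<alpha> > 0"
    and X_measurable [measurable]: "\<And>j. X j \<in> borel_measurable M"
    and X_decreasing: "AE \<omega> in M. \<forall>i j. i < j \<longrightarrow> X j \<omega> < X i \<omega>"
    and X_determinantal: "determinantal_point_process M (\<lambda>\<omega>. range (\<lambda>j. X j \<omega>)) Airy_kernel"
    and indep_Y: "indep_vars (\<lambda>_. borel) Y UNIV"
    and cdf_Y: "\<And>j x. cdf (distr M borel (Y j)) x = G_dist \<alpha> x"
    and indep_X_Y: "indep_var (Pi\<^sub>M UNIV (\<lambda>_. borel)) (\<lambda>\<omega> j. X j \<omega>) (Pi\<^sub>M UNIV (\<lambda>_. borel)) (\<lambda>\<omega> j. Y j \<omega>)"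
begin

lemma Y_measurable [measurable]: "Y j \<in> borel_measurable M"
  using indep_Y by (auto simp: indep_vars_def)

text \<open>The probability that every perturbed particle with index in \<open>S\<close> exceeds
  \<xi>, computed by conditioning on the unperturbed particles.\<close>

definition weight :: "real \<Rightarrow> nat set \<Rightarrow> ennreal" where
  "weight \<xi> S = (\<integral>\<^sup>+ \<omega>. (\<Prod>k\<in>S. ennreal (1 - G_dist \<alpha> (\<xi> - X k \<omega>))) \<partial>M)"

lemma weight_eq_ennreal: "weight \<xi> S = ennreal (enn2real (weight \<xi> S))"
proof -
  have "weight \<xi> S \<le> (\<integral>\<^sup>+ \<omega>. 1 \<partial>M)"
    unfolding weight_def
    using G_dist_bounds(1,2) by (intro nn_integral_mono) (auto simp: prod_ennreal intro!: prod_le_1)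
  then have "weight \<xi> S < \<infinity>" by (simp add: emeasure_space_1 order_le_less_trans)
  then show ?thesis by (simp add: less_top)
qed

lemma Airy_moment_eq_weights:
  "Airy_moment \<alpha> \<xi> n = (\<integral>\<^sup>+ j. weight \<xi> (j ` {..<n}) \<partial>count_space (injective_tuples n UNIV))"
proof (cases "n = 0")
  case True
  \<comment> \<open>Correlation functions are specified only from order 1 on. At order 0 there is a
    single tuple, the determinant and the empty weight are 1, and both sides equal 1.\<close>
  have "injective_tuples 0 UNIV = {\<lambda>_. undefined}" by (auto simp: injective_tuples_def)
  then show ?thesis
    using True by (simp add: Airy_moment_def PiM_empty nn_integral_count_space_finite kernel_det_def weight_def emeasure_space_1)
next
  case False
  define f where "f = (\<lambda>x :: nat \<Rightarrow> real. \<Prod>i<n. ennreal (1 - G_dist \<alpha> (\<xi> - x i)))"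
  have f: "f \<in> borel_measurable (Pi\<^sub>M {..<n} (\<lambda>_. lborel))"
    unfolding f_def by measurable
  have inj: "AE \<omega> in M. inj (\<lambda>j. X j \<omega>)"
    using X_decreasing by eventually_elim (metis linorder_injI order_less_irrefl)
  have corr: "correlation_function M (\<lambda>\<omega>. range (\<lambda>j. X j \<omega>)) n (kernel_det Airy_kernel n)"
    using X_determinantal False by (simp add: determinantal_point_process_def)
  have "Airy_moment \<alpha> \<xi> n = (\<integral>\<^sup>+ j. \<integral>\<^sup>+ \<omega>. f (\<lambda>i\<in>{..<n}. X (j i) \<omega>) \<partial>M \<partial>count_space (injective_tuples n UNIV))"
    unfolding Airy_moment_eq using correlation_function_nn_integral[OF prob_space_axioms X_measurable inj corr f]
    by (simp add: f_def)
  also have "\<dots> = (\<integral>\<^sup>+ j. weight \<xi> (j ` {..<n}) \<partial>count_space (injective_tuples n UNIV))"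
    unfolding weight_def f_def
    by (intro nn_integral_cong) (auto simp: injective_tuples_def prod.reindex)
  finally show ?thesis .
qed

text \<open>The expected \<open>n\<close>-th elementary symmetric polynomial of the first
  \<open>N\<close> exceedance probabilities.\<close>

definition elementary_weight :: "real \<Rightarrow> nat \<Rightarrow> nat \<Rightarrow> real" where
  "elementary_weight \<xi> n N = (\<Sum>S | S \<subseteq> {..<N} \<and> card S = n. enn2real (weight \<xi> S))"

lemma elementary_weight_nonneg: "0 \<le> elementary_weight \<xi> n N"
  unfolding elementary_weight_def by (intro sum_nonneg) simp

text \<open>The index space no longer depends on \<open>N\<close>; only the indicator does.
  Comparison with the full moment and monotone convergence in \<open>N\<close> become
  immediate.\<close>

lemma elementary_weight_eq_nn_integral:
  "ennreal (fact n * elementary_weight \<xi> n N) =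
    (\<integral>\<^sup>+ j. weight \<xi> (j ` {..<n}) * indicator (injective_tuples n {..<N}) j \<partial>count_space (injective_tuples n UNIV))"
proof -
  have "ennreal (fact n * elementary_weight \<xi> n N) = of_nat (fact n) * (\<Sum>S | S \<subseteq> {..<N} \<and> card S = n. weight \<xi> S)"
  proof -
    have "ennreal (fact n) = of_nat (fact n)"
      by (metis ennreal_of_nat_eq_real_of_nat of_nat_fact)
    moreover have "ennreal (\<Sum>S | S \<subseteq> {..<N} \<and> card S = n. enn2real (weight \<xi> S)) = (\<Sum>S | S \<subseteq> {..<N} \<and> card S = n. weight \<xi> S)"
      by (subst sum_ennreal[symmetric]) (simp_all flip: weight_eq_ennreal)
    ultimately show ?thesis
      unfolding elementary_weight_def by (subst ennreal_mult') simp_all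
  qed
  also have "\<dots> = (\<Sum>j\<in>injective_tuples n {..<N}. weight \<xi> (j ` {..<n}))"
    by (rule sum_injective_tuples[symmetric]) simp
  also have "\<dots> = (\<Sum>j\<in>injective_tuples n {..<N}. weight \<xi> (j ` {..<n}) * indicator (injective_tuples n {..<N}) j)"
    by simp
  also have "\<dots> = (\<integral>\<^sup>+ j. weight \<xi> (j ` {..<n}) * indicator (injective_tuples n {..<N}) j \<partial>count_space (injective_tuples n UNIV))"
  proof (rule nn_integral_count_space'[symmetric])
    show "finite (injective_tuples n {..<N})" by (intro finite_injective_tuples) simp
  qed (auto simp: injective_tuples_def PiE_iff)
  finally show ?thesis .
qed

lemma elementary_weight_le_moment: "ennreal (fact n * elementary_weight \<xi> n N) \<le> Airy_moment \<alpha> \<xi> n"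
  unfolding elementary_weight_eq_nn_integral Airy_moment_eq_weights
  by (intro nn_integral_mono) (auto simp: indicator_def)

lemma Airy_moment_finite: "Airy_moment \<alpha> \<xi> n < \<infinity>"
proof -
  obtain T where "Airy_moment \<alpha> \<xi> n \<le> ennreal (T ^ n)"
    using Airy_moment_bound[OF \<alpha>, of \<xi>] by blast
  then show ?thesis using order_le_less_trans ennreal_less_top by fastforce
qed

text \<open>Monotone convergence: a tuple has finitely many entries, so it eventually lies in
  \<open>{..<N}\<close>.\<close>

lemma elementary_weight_tendsto:
  "(\<lambda>N. fact n * elementary_weight \<xi> n N) \<longlonglongrightarrow> enn2real (Airy_moment \<alpha> \<xi> n)"
proof -
  have "(\<lambda>N. \<integral>\<^sup>+ j. weight \<xi> (j ` {..<n}) * indicator (injective_tuples n {..<N}) j \<partial>count_space (injective_tuples n UNIV))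
      \<longlonglongrightarrow> (\<integral>\<^sup>+ j. weight \<xi> (j ` {..<n}) * indicator (injective_tuples n UNIV) j \<partial>count_space (injective_tuples n UNIV))"
  proof (rule nn_integral_LIMSEQ)
    show "incseq (\<lambda>N j. weight \<xi> (j ` {..<n}) * indicator (injective_tuples n {..<N}) j)"
      by (force simp: incseq_def le_fun_def indicator_def injective_tuples_def PiE_iff)
    fix j
    show "(\<lambda>N. weight \<xi> (j ` {..<n}) * indicator (injective_tuples n {..<N}) j)
        \<longlonglongrightarrow> weight \<xi> (j ` {..<n}) * indicator (injective_tuples n UNIV) j"
    \<comment> \<open>For \<open>n = 0\<close> the maximum of the empty set is an unspecified value,
      which is harmless because there is no entry to bound.\<close>
    proof (rule tendsto_eventually, rule eventually_sequentiallyI[of "Suc (Max (j ` {..<n}))"])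
      fix N assume "Suc (Max (j ` {..<n})) \<le> N"
      then have "j i < N" if "i < n" for i
      proof -
        have "j i \<le> Max (j ` {..<n})" using that by (intro Max_ge) auto
        then show ?thesis using \<open>Suc (Max (j ` {..<n})) \<le> N\<close> by linarith
      qed
      then show "weight \<xi> (j ` {..<n}) * indicator (injective_tuples n {..<N}) j
          = weight \<xi> (j ` {..<n}) * indicator (injective_tuples n UNIV) j"
        by (auto simp: indicator_def injective_tuples_def PiE_iff)
    qed
  qed simp
  also have "(\<integral>\<^sup>+ j. weight \<xi> (j ` {..<n}) * indicator (injective_tuples n UNIV) j \<partial>count_space (injective_tuples n UNIV))
      = Airy_moment \<alpha> \<xi> n"
    unfolding Airy_moment_eq_weights by (intro nn_integral_cong) auto
  finally have "(\<lambda>N. ennreal (fact n * elementary_weight \<xi> n N)) \<longlonglongrightarrow> ennreal (enn2real (Airy_moment \<alpha> \<xi> n))"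
    unfolding elementary_weight_eq_nn_integral using Airy_moment_finite[of \<xi> n] by (simp add: less_top)
  then show ?thesis
    by (rule tendsto_ennrealD) (auto simp: elementary_weight_nonneg)
qed

text \<open>Inclusion-exclusion after conditioning: the product of \<open>1 - g\<close> over
  \<open>J\<close> is expanded over the subsets of \<open>J\<close> and integrated term by
  term.\<close>

lemma prob_all_le_eq:
  assumes "finite J"
  shows "prob {\<omega> \<in> space M. \<forall>j\<in>J. X j \<omega> + Y j \<omega> \<le> \<xi>} = (\<Sum>S\<in>Pow J. (- 1) ^ card S * enn2real (weight \<xi> S))"
proof -
  let ?g = "\<lambda>j \<omega>. 1 - G_dist \<alpha> (\<xi> - X j \<omega>)"
  have prod_bounds: "0 \<le> (\<Prod>k\<in>S. ?g k \<omega>)" "(\<Prod>k\<in>S. ?g k \<omega>) \<le> 1" for S \<omega>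
    using G_dist_bounds by (auto intro!: prod_nonneg prod_le_1)
  have int: "integrable M (\<lambda>\<omega>. \<Prod>k\<in>S. ?g k \<omega>)" for S
    using prod_bounds by (intro integrable_const_bound[where B = 1]) auto
  have weight: "enn2real (weight \<xi> S) = (LINT \<omega>|M. (\<Prod>k\<in>S. ?g k \<omega>))" for S
    unfolding weight_def using prod_bounds(1) G_dist_bounds(1)
    by (subst integral_eq_nn_integral) (auto simp: prod_ennreal)
  have "prob {\<omega> \<in> space M. \<forall>j\<in>J. X j \<omega> + Y j \<omega> \<le> \<xi>} = enn2real (\<integral>\<^sup>+ \<omega>. ennreal (\<Prod>j\<in>J. G_dist \<alpha> (\<xi> - X j \<omega>)) \<partial>M)"
    unfolding measure_def prob_all_perturbed_le[OF indep_Y cdf_Y indep_X_Y assms] ..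
  also have "\<dots> = (LINT \<omega>|M. (\<Prod>j\<in>J. G_dist \<alpha> (\<xi> - X j \<omega>)))"
    using G_dist_bounds by (subst integral_eq_nn_integral) (auto intro!: prod_nonneg)
  also have "\<dots> = (LINT \<omega>|M. (\<Sum>S\<in>Pow J. (- 1) ^ card S * (\<Prod>k\<in>S. ?g k \<omega>)))"
    using prod_diff_conv_sum[OF assms, of "\<lambda>_. 1 :: real" "\<lambda>j. ?g j _"] by simp
  also have "\<dots> = (\<Sum>S\<in>Pow J. (- 1) ^ card S * (LINT \<omega>|M. (\<Prod>k\<in>S. ?g k \<omega>)))"
    using int by simp
  finally show ?thesis by (simp add: weight)
qed

text \<open>Subsets are grouped by cardinality. The infinite sum, with zero terms beyond
  \<open>N\<close>, and the cancelling factorials put the result in the shape of the Fredholm series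
  for a termwise limit.\<close>

lemma prob_first_le_eq_suminf:
  "prob {\<omega> \<in> space M. \<forall>j\<in>{..<N}. X j \<omega> + Y j \<omega> \<le> \<xi>} = (\<Sum>n. (- 1) ^ n / fact n * (fact n * elementary_weight \<xi> n N))"
proof -
  have zero: "elementary_weight \<xi> n N = 0" if "n \<notin> {..N}" for n
  proof -
    have "card S \<le> N" if "S \<subseteq> {..<N}" for S
      using card_mono[OF _ that] by simp
    then have "{S. S \<subseteq> {..<N} \<and> card S = n} = {}"
      using that by auto
    then show ?thesis by (simp only: elementary_weight_def sum.empty)
  qed
  have "prob {\<omega> \<in> space M. \<forall>j\<in>{..<N}. X j \<omega> + Y j \<omega> \<le> \<xi>} = (\<Sum>S\<in>Pow {..<N}. (- 1) ^ card S * enn2real (weight \<xi> S))"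
    by (rule prob_all_le_eq) simp
  also have "\<dots> = (\<Sum>n\<le>N. \<Sum>S\<in>{S \<in> Pow {..<N}. card S = n}. (- 1) ^ card S * enn2real (weight \<xi> S))"
    by (rule sum.group[symmetric]) (use card_mono[of "{..<N}"] in auto)
  also have "\<dots> = (\<Sum>n\<le>N. (- 1) ^ n / fact n * (fact n * elementary_weight \<xi> n N))"
    by (intro sum.cong refl) (simp add: elementary_weight_def sum_distrib_left)
  also have "\<dots> = (\<Sum>n. (- 1) ^ n / fact n * (fact n * elementary_weight \<xi> n N))"
    by (intro suminf_finite[symmetric]) (auto simp: zero)
  finally show ?thesis .
qed

text \<open>The probabilities for the first \<open>N\<close> particles converge in two ways: to the
  probability of the intersection, by continuity from above, and to the Fredholm series, by
  Tannery's theorem with the summable majorant \<open>T ^ n / fact n\<close>.\<close>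

lemma prob_all_le_eq_F_dist: "prob {\<omega> \<in> space M. \<forall>j. X j \<omega> + Y j \<omega> \<le> \<xi>} = F_dist \<alpha> \<xi>"
proof -
  obtain T where T: "T \<ge> 0" "\<And>n. Airy_moment \<alpha> \<xi> n \<le> ennreal (T ^ n)"
    using Airy_moment_bound[OF \<alpha>, of \<xi>] by blast
  define a where "a = (\<lambda>n N. (- 1) ^ n / fact n * (fact n * elementary_weight \<xi> n N))"
  have bound: "norm (a n N) \<le> inverse (fact n) * T ^ n" for n N
  proof -
    have "ennreal (fact n * elementary_weight \<xi> n N) \<le> ennreal (T ^ n)"
      using elementary_weight_le_moment T(2) by (rule order_trans)
    then have "fact n * elementary_weight \<xi> n N \<le> T ^ n"
      using T(1) by (simp add: ennreal_le_iff)
    then have "inverse (fact n) * (fact n * elementary_weight \<xi> n N) \<le> inverse (fact n) * T ^ n"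
      by (intro mult_left_mono) auto
    moreover have "norm (a n N) = inverse (fact n) * (fact n * elementary_weight \<xi> n N)"
      using elementary_weight_nonneg[of \<xi> n N] by (simp add: a_def abs_mult)
    ultimately show ?thesis by simp
  qed
  have "(\<lambda>N. suminf (\<lambda>n. a n N)) \<longlonglongrightarrow> (\<Sum>n. (- 1) ^ n / fact n * enn2real (Airy_moment \<alpha> \<xi> n))"
  proof (rule tannerys_theorem[THEN conjunct2, THEN conjunct2])
    show "(\<lambda>N. a n N) \<longlonglongrightarrow> (- 1) ^ n / fact n * enn2real (Airy_moment \<alpha> \<xi> n)" for n
      unfolding a_def by (intro tendsto_mult_left elementary_weight_tendsto)
    show "\<forall>\<^sub>F (n, N) in sequentially \<times>\<^sub>F sequentially. norm (a n N) \<le> inverse (fact n) * T ^ n"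
      by (intro always_eventually) (use bound in auto)
    show "summable (\<lambda>n. inverse (fact n) * T ^ n)" by (rule summable_exp)
  qed simp
  moreover have "(\<Sum>n. (- 1) ^ n / fact n * enn2real (Airy_moment \<alpha> \<xi> n)) = F_dist \<alpha> \<xi>"
    unfolding F_dist_def Fredholm_det_def Fredholm_term_eq_Airy_moment[OF \<alpha>] ..
  ultimately have "(\<lambda>N. prob {\<omega> \<in> space M. \<forall>j\<in>{..<N}. X j \<omega> + Y j \<omega> \<le> \<xi>}) \<longlonglongrightarrow> F_dist \<alpha> \<xi>"
    by (simp add: prob_first_le_eq_suminf a_def)
  moreover have "(\<lambda>N. prob {\<omega> \<in> space M. \<forall>j\<in>{..<N}. X j \<omega> + Y j \<omega> \<le> \<xi>})
      \<longlonglongrightarrow> prob (\<Inter>N. {\<omega> \<in> space M. \<forall>j\<in>{..<N}. X j \<omega> + Y j \<omega> \<le> \<xi>})"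
    by (rule finite_Lim_measure_decseq) (auto simp: decseq_def)
  moreover have "(\<Inter>N. {\<omega> \<in> space M. \<forall>j\<in>{..<N}. X j \<omega> + Y j \<omega> \<le> \<xi>}) = {\<omega> \<in> space M. \<forall>j. X j \<omega> + Y j \<omega> \<le> \<xi>}"
    by auto
  ultimately show ?thesis using LIMSEQ_unique by fastforce
qed

section \<open>Almost sure attainment of the maximum\<close>

lemma AE_eventually_le: "AE \<omega> in M. \<forall>\<^sub>F j in sequentially. X j \<omega> + Y j \<omega> \<le> t"
proof -
  have prob_gt: "prob {\<omega> \<in> space M. t < X j \<omega> + Y j \<omega>} = enn2real (weight t {j})" for j
  proof -
    have "prob {\<omega> \<in> space M. \<not> (X j \<omega> + Y j \<omega> \<le> t)} = 1 - prob {\<omega> \<in> space M. X j \<omega> + Y j \<omega> \<le> t}"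
      by (rule prob_neg) measurable
    moreover have "Pow {j} = {{}, {j}}" by auto
    then have "prob {\<omega> \<in> space M. X j \<omega> + Y j \<omega> \<le> t} = 1 - enn2real (weight t {j})"
      using prob_all_le_eq[of "{j}" t] by (simp add: weight_def[of _ "{}"] emeasure_space_1)
    ultimately show ?thesis by (simp add: not_le)
  qed
  \<comment> \<open>The singleton weights are the tail probabilities, and their partial sums are
    bounded by the first moment. This is the summability that Borel-Cantelli requires.\<close>
  have partial: "(\<Sum>j<N. enn2real (weight t {j})) \<le> enn2real (Airy_moment \<alpha> t 1)" for N
  proof -
    have "{S. S \<subseteq> {..<N} \<and> card S = 1} = (\<lambda>j. {j}) ` {..<N}"
      by (auto simp: card_1_singleton_iff)
    then have "elementary_weight t 1 N = (\<Sum>j<N. enn2real (weight t {j}))"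
      unfolding elementary_weight_def by (simp add: sum.reindex)
    then show ?thesis
      using elementary_weight_le_moment[of 1 t N] Airy_moment_finite[of t 1] elementary_weight_nonneg[of t 1 N]
      by (metis enn2real_ennreal enn2real_mono fact_1 infinity_ennreal_def mult_1)
  qed
  have "summable (\<lambda>j. prob {\<omega> \<in> space M. t < X j \<omega> + Y j \<omega>})"
    unfolding prob_gt using partial by (intro summableI_nonneg_bounded) auto
  then have "AE \<omega> in M. \<forall>\<^sub>F j in sequentially. \<omega> \<in> space M - {\<omega> \<in> space M. t < X j \<omega> + Y j \<omega>}"
    by (intro borel_cantelli_AE1) (auto simp: less_top[symmetric])
  then show ?thesis
    by eventually_elim (auto elim: eventually_mono)
qed

text \<open>Countably many thresholds \<open>- real m\<close> show that the perturbed particles tend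
  to minus infinity, so a maximum over finitely many indices is a global one.\<close>

lemma AE_max_attained:
  "AE \<omega> in M. \<exists>k. \<forall>j. X j \<omega> + Y j \<omega> \<le> X k \<omega> + Y k \<omega>"
proof -
  have "AE \<omega> in M. \<forall>m::nat. \<forall>\<^sub>F j in sequentially. X j \<omega> + Y j \<omega> \<le> - real m"
    unfolding AE_all_countable using AE_eventually_le by blast
  then show ?thesis
  proof eventually_elim
    fix \<omega> assume ev: "\<forall>m::nat. \<forall>\<^sub>F j in sequentially. X j \<omega> + Y j \<omega> \<le> - real m"
    define z where "z = (\<lambda>j. X j \<omega> + Y j \<omega>)"
    \<comment> \<open>The threshold lies below \<open>z 0\<close>, so the indices beyond
      \<open>N\<close> cannot compete with index 0, which belongs to \<open>{..N}\<close>.\<close>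
    obtain m :: nat where m: "- z 0 < real m" using reals_Archimedean2 by blast
    obtain N where N: "\<And>j. N \<le> j \<Longrightarrow> z j \<le> - real m"
      using ev[rule_format, of m] by (auto simp: eventually_sequentially z_def)
    have "Max (z ` {..N}) \<in> z ` {..N}" by (intro Max_in) auto
    then obtain k where k: "Max (z ` {..N}) = z k" by (rule imageE)
    have le: "z j \<le> z k" if "j \<le> N" for j
      unfolding k[symmetric] using that by (intro Max_ge) auto
    have "z j \<le> z k" for j
      using le[of j] le[of 0] N[of j] m by (cases "j \<le> N") auto
    then show "\<exists>k. \<forall>j. X j \<omega> + Y j \<omega> \<le> X k \<omega> + Y k \<omega>" unfolding z_def by blast
  qed
qed

text \<open>Once a maximiser exists, its lying below \<xi> is the same as all perturbed particles
  lying below \<xi>; the two events differ only on a null set.\<close>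

theorem prob_max_le:
  "prob {\<omega> \<in> space M. \<exists>k. (\<forall>j. X j \<omega> + Y j \<omega> \<le> X k \<omega> + Y k \<omega>) \<and> X k \<omega> + Y k \<omega> \<le> \<xi>} = F_dist \<alpha> \<xi>"
proof -
  have "prob {\<omega> \<in> space M. \<exists>k. (\<forall>j. X j \<omega> + Y j \<omega> \<le> X k \<omega> + Y k \<omega>) \<and> X k \<omega> + Y k \<omega> \<le> \<xi>} =
      prob {\<omega> \<in> space M. \<forall>j. X j \<omega> + Y j \<omega> \<le> \<xi>}"
    by (rule measure_eq_AE, use AE_max_attained in eventually_elim) (auto intro: order_trans)
  then show ?thesis by (simp add: prob_all_le_eq_F_dist)
qed

end

theorem proposition1p4:
  fixes M :: "'w measure"
    and X Y :: "nat \<Rightarrow> 'w \<Rightarrow> real"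
    and \<alpha> \<xi> :: real
  assumes "\<alpha> > 0"
    and "prob_space M"
    and "\<And>j. X j \<in> borel_measurable M"
    and "AE \<omega> in M. \<forall>i j. i < j \<longrightarrow> X j \<omega> < X i \<omega>"
    and "determinantal_point_process M (\<lambda>\<omega>. range (\<lambda>j. X j \<omega>)) Airy_kernel"
    and "prob_space.indep_vars M (\<lambda>_. borel) Y UNIV"
    and "\<And>j x. cdf (distr M borel (Y j)) x = G_dist \<alpha> x"
    and "prob_space.indep_var M
           (Pi\<^sub>M UNIV (\<lambda>_. borel)) (\<lambda>\<omega> j. X j \<omega>)
           (Pi\<^sub>M UNIV (\<lambda>_. borel)) (\<lambda>\<omega> j. Y j \<omega>)"
  shows "measure M {\<omega> \<in> space M.
           \<exists>k. (\<forall>j. X j \<omega> + Y j \<omega> \<le> X k \<omega> + Y k \<omega>) \<and> X k \<omega> + Y k \<omega> \<le> \<xi>}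
         = F_dist \<alpha> \<xi>"
proof -
  interpret prob_space M by fact
  interpret perturbed_Airy_process M X Y \<alpha>
    by unfold_locales (fact assms)+
  show ?thesis by (rule prob_max_le)
qed

end
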